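(* Let $S$ be a finite inverse semigroup with natural partial order $\leq$, and let $\mu$ be the M\"obius function of $(S,\leq)$. Let $\mathcal X$ be any complete set of inequivalent, irreducible matrix representations of $\mathbb C S$, and let $f=\sum_{s\in S} f(s)s\in\mathbb C S$. For $t\in S$, let $G(t)$ denote the maximal subgroup of $S$ at any idempotent of the $\mathcal D$-class of $t$, and let $r(t)$ denote the number of idempotents in the $\mathcal D$-class of $t$. Then for every $s\in S$, \[ f(s)=\sum_{\rho\in\mathcal X} d_\rho \sum_{t\in S:\,t\geq s}\frac{\mu(s,t)}{r(t)|G(t)|}\sum_{v\in S:\,v^{-1}\leq t^{-1}}\mu(v^{-1},t^{-1})\,\mathrm{trace}\!\left(\hat f(\rho)\rho(v^{-1})\right). \]
   Context: An inverse semigroup is a semigroup $S$ in which each $x$ has a unique $x^{-1}\in S$ with $xx^{-1}x=x$ and $x^{-1}xx^{-1}=x^{-1}$. Write $\mathrm{dom}(s)=s^{-1}s$ and $\mathrm{ran}(s)=ss^{-1}$ (both are idempotents of $S$). Natural partial order: $t\leq s$ iff $t=es$ for some idempotent $e\in S$. $\mathcal D$-relation: $s\mathrel{\mathcal D}t$ iff there is $x\in S$ with $\mathrm{dom}(x)=\mathrm{ran}(s)$ and $\mathrm{ran}(x)=\mathrm{ran}(t)$; this is an equivalence relation whose classes are the $\mathcal D$-classes. The maximal subgroup at an idempotent $e$ is $G_e=\{s\in S:\mathrm{dom}(s)=\mathrm{ran}(s)=e\}$, a group with identity $e$; up to isomorphism it depends only on the $\mathcal D$-class of $e$. $\mathbb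 C S$ is the semigroup algebra with natural basis $S$ (it is semisimple). A (matrix) representation $\rho$ of $\mathbb C S$ is an algebra homomorphism $\rho:\mathbb C S\to M_{d_\rho}(\mathbb C)$; $d_\rho$ is its dimension. A complete set of inequivalent, irreducible representations contains exactly one representative of each equivalence class of irreducible (in particular nonzero) representations. The Fourier transform of $f$ at $\rho$ is $\hat f(\rho)=\rho(f)=\sum_{s\in S}f(s)\rho(s)$. *)

theory Defs
  imports "Jordan_Normal_Form.VS_Connect"
begin

section \<open>Inverse semigroups\<close>

class inverse_semigroup = semigroup_mult +
  assumes ex1_semigroup_inverse: "\<exists>!y. x * y * x = x \<and> y * x * y = y"

definition sinv :: "'a::inverse_semigroup \<Rightarrow> 'a" where
  "sinv x = (THE y. x * y * x = x \<and> y * x * y = y)"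

definition sdom :: "'a::inverse_semigroup \<Rightarrow> 'a" where
  "sdom s = sinv s * s"

definition sran :: "'a::inverse_semigroup \<Rightarrow> 'a" where
  "sran s = s * sinv s"

definition is_idempotent :: "'a::semigroup_mult \<Rightarrow> bool" where
  "is_idempotent e \<longleftrightarrow> e * e = e"

definition natural_le :: "'a::inverse_semigroup \<Rightarrow> 'a \<Rightarrow> bool" where
  "natural_le t s \<longleftrightarrow> (\<exists>e. is_idempotent e \<and> t = e * s)"

definition D_rel :: "'a::inverse_semigroup \<Rightarrow> 'a \<Rightarrow> bool" where
  "D_rel s t \<longleftrightarrow> (\<exists>x. sdom x = sran s \<and> sran x = sran t)"

definition D_class :: "'a::inverse_semigroup \<Rightarrow> 'a set" where
  "D_class t = {s. D_rel s t}"

definition maximal_subgroup :: "'a::inverse_semigroup \<Rightarrow> 'a set" where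
  "maximal_subgroup e = {s. sdom s = e \<and> sran s = e}"

definition num_idempotents :: "'a::inverse_semigroup \<Rightarrow> nat" where
  "num_idempotents t = card {e \<in> D_class t. is_idempotent e}"

lemma sinv_props:
  fixes x :: "'a::inverse_semigroup"
  shows "x * sinv x * x = x" "sinv x * x * sinv x = sinv x"
  using theI'[OF ex1_semigroup_inverse[of x]] unfolding sinv_def by auto

lemma sinv_unique:
  fixes x y :: "'a::inverse_semigroup"
  assumes "x * y * x = x" "y * x * y = y"
  shows "sinv x = y"
  using ex1_semigroup_inverse[of x] assms sinv_props[of x] by blast

lemma idempotent_mult:
  fixes e f :: "'a::inverse_semigroup"
  assumes e: "is_idempotent e" and f: "is_idempotent f"
  shows "is_idempotent (e * f)"
proof -
  have ee: "e * e = e" "\<And>z. e * (e * z) = e * z"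
    and ff: "f * f = f" "\<And>z. f * (f * z) = f * z"
    using e f unfolding is_idempotent_def by (simp_all flip: mult.assoc)
  define x where "x = sinv (e * f)"
  have x1: "e * (f * (x * (e * f))) = e * f"
    and x2: "x * (e * (f * x)) = x"
    using sinv_props[of "e * f"] unfolding x_def by (simp_all add: mult.assoc)
  have x2': "x * (e * (f * (x * z))) = x * z" for z
    using arg_cong[OF x2, of "\<lambda>w. w * z"] by (simp add: mult.assoc)
  have "sinv (e * f) = f * (x * e)"
    by (rule sinv_unique) (simp_all add: mult.assoc ee ff x1 x2')
  with x_def have x3: "x = f * (x * e)" by (rule trans)
  have "(f * (x * e)) * (f * (x * e)) = f * (x * e)" by (simp add: mult.assoc x2')
  then have xx: "x * x = x" unfolding x3[symmetric] .
  have "sinv x = x" by (rule sinv_unique) (simp_all add: xx)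
  moreover have "sinv x = e * f"
    by (rule sinv_unique) (simp_all add: mult.assoc x1 x2)
  ultimately have "x = e * f" by simp
  with xx show ?thesis unfolding is_idempotent_def by blast
qed

lemma idempotent_commute:
  fixes e f :: "'a::inverse_semigroup"
  assumes e: "is_idempotent e" and f: "is_idempotent f"
  shows "e * f = f * e"
proof -
  have ee: "\<And>z. e * (e * z) = e * z" and ff: "\<And>z. f * (f * z) = f * z"
    using e f unfolding is_idempotent_def by (simp_all flip: mult.assoc)
  have ef: "e * (f * (e * f)) = e * f" and fe: "f * (e * (f * e)) = f * e"
    using idempotent_mult[OF e f] idempotent_mult[OF f e]
    unfolding is_idempotent_def by (simp_all add: mult.assoc)
  have "sinv (e * f) = e * f"
    by (rule sinv_unique) (simp_all add: mult.assoc ef ee ff)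
  moreover have "sinv (e * f) = f * e"
    by (rule sinv_unique) (simp_all add: mult.assoc ef fe ee ff)
  ultimately show ?thesis by simp
qed

lemma natural_le_refl: "natural_le s s"
  unfolding natural_le_def is_idempotent_def
  by (rule exI[of _ "s * sinv s"]) (simp add: sinv_props flip: mult.assoc)

lemma natural_le_trans:
  assumes "natural_le r s" "natural_le s t"
  shows "natural_le r t"
proof -
  from assms obtain e f where "is_idempotent e" "r = e * s" "is_idempotent f" "s = f * t"
    unfolding natural_le_def by auto
  then have "is_idempotent (e * f)" "r = (e * f) * t"
    by (auto intro: idempotent_mult simp: mult.assoc)
  then show ?thesis unfolding natural_le_def by blast
qed

lemma natural_le_antisym:
  assumes "natural_le s t" "natural_le t s"
  shows "s = t"
proof -
  from assms obtain e f where e: "is_idempotent e" "s = e * t" and f: "is_idempotent f" "t = f * s"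
    unfolding natural_le_def by auto
  have "e * s = e * e * t" unfolding e(2) by (simp only: mult.assoc)
  also have "\<dots> = e * t" using e(1) unfolding is_idempotent_def by (rule arg_cong)
  also have "\<dots> = s" by (rule e(2)[symmetric])
  finally have es: "e * s = s" .
  have "s = e * t" by (rule e(2))
  also have "e * t = e * (f * s)" by (rule arg_cong[OF f(2)])
  also have "\<dots> = e * f * s" by (rule mult.assoc[symmetric])
  also have "\<dots> = f * e * s" by (rule arg_cong[OF idempotent_commute[OF e(1) f(1)]])
  also have "\<dots> = f * s" by (simp only: mult.assoc es)
  also have "\<dots> = t" by (rule f(2)[symmetric])
  finally show ?thesis .
qed

function moebius :: "'a::{finite,inverse_semigroup} \<Rightarrow> 'a \<Rightarrow> int" where
  "moebius s t =
     (if s = t then 1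
      else if natural_le s t
      then - (\<Sum>u | natural_le s u \<and> natural_le u t \<and> u \<noteq> t. moebius s u)
      else 0)"
  by auto
termination
proof (relation "measure (\<lambda>(s, t). card {w. natural_le w t})")
  fix s t u :: 'a
  assume "u \<in> {u. natural_le s u \<and> natural_le u t \<and> u \<noteq> t}"
  then have u: "natural_le u t" "u \<noteq> t" by auto
  have "{w. natural_le w u} \<subset> {w. natural_le w t}"
    using u natural_le_trans natural_le_antisym natural_le_refl by blast
  then show "((s, u), s, t) \<in> measure (\<lambda>(s, t). card {w. natural_le w t})"
    by (simp add: psubset_card_mono)
qed simp

declare moebius.simps [simp del]

section \<open>The semigroup algebra and its matrix representations\<close>

text \<open>An element of the semigroup algebra is identified with its coefficient function.\<close>

type_synonym 'a semigroup_algebra = "'a \<Rightarrow> complex"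

definition alg_basis :: "'a \<Rightarrow> 'a semigroup_algebra" where
  "alg_basis s = (\<lambda>u. if u = s then 1 else 0)"

definition alg_mult ::
  "'a::{finite,semigroup_mult} semigroup_algebra \<Rightarrow> 'a semigroup_algebra \<Rightarrow> 'a semigroup_algebra" where
  "alg_mult f g = (\<lambda>u. \<Sum>(x, y) | x * y = u. f x * g y)"

type_synonym 'a mat_rep = "'a semigroup_algebra \<Rightarrow> complex mat"

definition rep_dim :: "'a mat_rep \<Rightarrow> nat" where
  "rep_dim \<rho> = dim_row (\<rho> (\<lambda>_. 0))"

text \<open>Representations are not required to send the identity of the algebra to the identity matrix.\<close>

definition is_rep :: "'a::{finite,semigroup_mult} mat_rep \<Rightarrow> bool" where
  "is_rep \<rho> \<longleftrightarrow>
     (\<forall>f. \<rho> f \<in> carrier_mat (rep_dim \<rho>) (rep_dim \<rho>)) \<and>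
     (\<forall>f g. \<rho> (\<lambda>s. f s + g s) = \<rho> f + \<rho> g) \<and>
     (\<forall>c f. \<rho> (\<lambda>s. c * f s) = c \<cdot>\<^sub>m \<rho> f) \<and>
     (\<forall>f g. \<rho> (alg_mult f g) = \<rho> f * \<rho> g)"

definition invariant_subspace :: "'a mat_rep \<Rightarrow> complex vec set \<Rightarrow> bool" where
  "invariant_subspace \<rho> W \<longleftrightarrow>
     subspace class_ring W (module_vec TYPE(complex) (rep_dim \<rho>)) \<and>
     (\<forall>f. \<forall>w\<in>W. \<rho> f *\<^sub>v w \<in> W)"

text \<open>The nonvanishing condition excludes dimension zero as well as the one-dimensional zero
  representation.\<close>

definition irreducible_rep :: "'a::{finite,semigroup_mult} mat_rep \<Rightarrow> bool" where
  "irreducible_rep \<rho> \<longleftrightarrow>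
     is_rep \<rho> \<and>
     (\<exists>f. \<rho> f \<noteq> 0\<^sub>m (rep_dim \<rho>) (rep_dim \<rho>)) \<and>
     (\<forall>W. invariant_subspace \<rho> W \<longrightarrow> W = {0\<^sub>v (rep_dim \<rho>)} \<or> W = carrier_vec (rep_dim \<rho>))"

text \<open>One pair of mutually inverse matrices conjugates all values simultaneously;
  \<^const>\<open>similar_mat_wit\<close> also forces the dimensions to agree.\<close>

definition equivalent_rep :: "'a mat_rep \<Rightarrow> 'a mat_rep \<Rightarrow> bool" where
  "equivalent_rep \<rho> \<sigma> \<longleftrightarrow> (\<exists>P Q. \<forall>f. similar_mat_wit (\<rho> f) (\<sigma> f) P Q)"

definition complete_irreducible_reps :: "'a::{finite,semigroup_mult} mat_rep set \<Rightarrow> bool" where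
  "complete_irreducible_reps X \<longleftrightarrow>
     (\<forall>\<rho>\<in>X. irreducible_rep \<rho>) \<and>
     (\<forall>\<sigma>. irreducible_rep \<sigma> \<longrightarrow> (\<exists>!\<rho>. \<rho> \<in> X \<and> equivalent_rep \<rho> \<sigma>))"

definition fourier_transform :: "'a semigroup_algebra \<Rightarrow> 'a mat_rep \<Rightarrow> complex mat" where
  "fourier_transform f \<rho> = \<rho> f"

definition mat_trace :: "complex mat \<Rightarrow> complex" where
  "mat_trace A = (\<Sum>i<dim_row A. A $$ (i, i))"

end

theory Submission
  imports Defs "Jordan_Normal_Form.Spectral_Radius" "Jordan_Normal_Form.DL_Rank"
begin

text \<open>In the algebra of a finite inverse semigroup the elements
  \<open>\<lfloor>t\<rfloor> = (\<Sum>v \<le> t. \<mu>(v, t) v)\<close> form a basis that multiplies like the arrows of a groupoid: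
  \<open>\<lfloor>x\<rfloor> \<lfloor>y\<rfloor> = \<lfloor>x y\<rfloor>\<close> if \<open>dom x = ran y\<close>, and the product is \<open>0\<close> otherwise. Since
  \<open>s = (\<Sum>t \<le> s. \<lfloor>t\<rfloor>)\<close>, the coefficient of \<open>f\<close> at \<open>\<lfloor>t\<rfloor>\<close> is \<open>F(t) = (\<Sum>s \<ge> t. f(s))\<close>, and
  Moebius inversion recovers \<open>f(s) = (\<Sum>t \<ge> s. \<mu>(s, t) F(t))\<close>. The theorem therefore amounts to
  \<open>F(t) = (\<Sum>\<rho>. d\<^sub>\<rho> trace (\<rho>(f) \<rho>\<lfloor>t\<^sup>-\<^sup>1\<rfloor>)) / n(t)\<close>, where \<open>n(t) = r(t) |G(t)|\<close> is the number of arrows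
  with the same range as \<open>t\<close> (lemma \<open>arrows_onto_sran\<close>). If the semigroup is a
  group, then \<open>\<lfloor>t\<rfloor> = t\<close> and this is the classical Fourier inversion formula.

  The proof of the latter follows the pattern used for groups. For any matrix \<open>M\<close> the average
  \<open>(\<Sum>t. \<rho>\<lfloor>t\<rfloor> M \<sigma>\<lfloor>t\<^sup>-\<^sup>1\<rfloor> / n(t))\<close> intertwines \<open>\<rho>\<close> and \<open>\<sigma>\<close>, because translation by \<open>s\<close> permutes
  the groupoid basis partially and preserves \<open>n\<close>. Schur's lemma then gives orthogonality of the
  matrix coefficients (\<open>schur_orthogonality\<close>); the scalar is found by taking a trace, which turns
  \<open>(\<Sum>t. \<lfloor>t\<^sup>-\<^sup>1\<rfloor> \<lfloor>t\<rfloor> / n(t))\<close> into the identity \<open>(\<Sum>e. \<lfloor>e\<rfloor>)\<close> of the algebra. Orthogonality makes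
  the set of irreducible representations finite, and it shows that the right-hand side of the
  theorem, as an element of the algebra, has the same image as \<open>f\<close> under every irreducible
  representation.

  It remains to see that the irreducible representations separate the elements of the algebra
  (\<open>irreducibles_separate\<close>). If all of them vanish on \<open>a\<close>, they vanish on every product \<open>a b\<close>, so a
  composition series shows that \<open>a b\<close> has trace \<open>0\<close> in every representation, in particular in the
  action of the semigroup on itself by partial bijections. For \<open>b = \<lfloor>t\<^sup>-\<^sup>1\<rfloor>\<close> that trace
  equals \<open>n(t)\<close> times the coefficient of \<open>a\<close> at \<open>\<lfloor>t\<rfloor>\<close>, so all these coefficients vanish.

  Representations enter the computations through their matrix coefficients, complex functions on
  the semigroup. The value of such a function at \<open>\<lfloor>t\<rfloor>\<close>, after linear extension, is its
  \<open>moebius_transform\<close> at \<open>t\<close>.\<close>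

section \<open>Inverse semigroups and their natural order\<close>

lemma sinv_assoc [simp]:
  fixes x :: "'a::inverse_semigroup"
  shows "x * (sinv x * x) = x" "x * (sinv x * (x * z)) = x * z"
    "sinv x * (x * sinv x) = sinv x" "sinv x * (x * (sinv x * z)) = sinv x * z"
  using sinv_props[of x] by (metis mult.assoc)+

lemma sinv_sinv [simp]: "sinv (sinv x) = (x::'a::inverse_semigroup)"
  by (rule sinv_unique) (simp_all add: mult.assoc)

lemma sinv_idempotent: "is_idempotent e \<Longrightarrow> sinv e = (e::'a::inverse_semigroup)"
  by (rule sinv_unique) (simp_all add: is_idempotent_def)

lemma is_idempotent_sran [simp]: "is_idempotent (sran (x::'a::inverse_semigroup))"
  and is_idempotent_sdom [simp]: "is_idempotent (sdom (x::'a::inverse_semigroup))"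
  by (simp_all add: is_idempotent_def sran_def sdom_def mult.assoc)

lemma sinv_mult: "sinv (x * y) = sinv y * sinv (x::'a::inverse_semigroup)"
proof (rule sinv_unique)
  have c: "sran y * sdom x = sdom x * sran y"
    by (rule idempotent_commute) simp_all
  have c1: "y * (sinv y * (sinv x * (x * z))) = sinv x * (x * (y * (sinv y * z)))" for z
    using arg_cong[OF c, of "\<lambda>w. w * z"] by (simp add: sran_def sdom_def mult.assoc)
  show "x * y * (sinv y * sinv x) * (x * y) = x * y"
    by (simp add: mult.assoc c1)
  show "sinv y * sinv x * (x * y) * (sinv y * sinv x) = sinv y * sinv x"
    using c1[of "sinv x"] by (simp add: mult.assoc flip: c1)
qed

lemma sran_sinv [simp]: "sran (sinv x) = sdom (x::'a::inverse_semigroup)"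
  and sdom_sinv [simp]: "sdom (sinv x) = sran x"
  by (simp_all add: sran_def sdom_def)

lemma sran_mult_self [simp]: "sran x * x = (x::'a::inverse_semigroup)"
  and mult_sdom_self [simp]: "x * sdom x = x"
  by (simp_all add: sran_def sdom_def mult.assoc)

lemma sran_idempotent: "is_idempotent e \<Longrightarrow> sran e = (e::'a::inverse_semigroup)"
  and sdom_idempotent: "is_idempotent e \<Longrightarrow> sdom e = e"
  by (simp_all add: sran_def sdom_def sinv_idempotent) (simp_all add: is_idempotent_def)

lemma natural_le_iff_sran: "natural_le t s \<longleftrightarrow> t = sran t * (s::'a::inverse_semigroup)"
proof
  assume "natural_le t s"
  then obtain e where e: "is_idempotent e" and t: "t = e * s"
    unfolding natural_le_def by blast
  have ee: "e * e = e" "\<And>z. e * (e * z) = e * z"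
    using e unfolding is_idempotent_def by (simp_all flip: mult.assoc)
  have "sran t = e * (sran s * e)"
    by (simp add: t sran_def sinv_mult sinv_idempotent[OF e] mult.assoc)
  also have "sran s * e = e * sran s"
    by (rule idempotent_commute) (simp_all add: e)
  finally show "t = sran t * s" by (simp add: t ee mult.assoc)
next
  assume "t = sran t * s"
  then show "natural_le t s" unfolding natural_le_def
    by (intro exI[of _ "sran t"] conjI is_idempotent_sran)
qed

text \<open>An idempotent on the right of \<open>s\<close> can be moved to its left by conjugation with \<open>s\<close>. Hence the
  natural order, defined by idempotent factors on the left, may equally be defined by factors on
  the right, and inversion preserves it.\<close>

lemma mult_idempotent_right:
  assumes f: "is_idempotent f"
  shows "s * f = (s * f * sinv s) * (s::'a::inverse_semigroup)" "is_idempotent (s * f * sinv s)"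
proof -
  have c: "f * (sinv s * s) = sinv s * s * f"
    using idempotent_commute[OF f is_idempotent_sdom[of s]] by (simp add: sdom_def)
  have c': "f * (sinv s * (s * z)) = sinv s * (s * (f * z))" for z
    using arg_cong[OF c, of "\<lambda>w. w * z"] by (simp add: mult.assoc)
  have ff: "f * f = f" "\<And>z. f * (f * z) = f * z"
    using f unfolding is_idempotent_def by (simp_all flip: mult.assoc)
  show "s * f = (s * f * sinv s) * s" using c by (simp add: mult.assoc)
  show "is_idempotent (s * f * sinv s)" unfolding is_idempotent_def
    by (simp add: mult.assoc c' ff)
qed

lemma natural_le_sinv:
  "natural_le t s \<Longrightarrow> natural_le (sinv t) (sinv (s::'a::inverse_semigroup))"
proof -
  assume "natural_le t s"
  then have "sinv t = sinv s * sran t"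
    unfolding natural_le_iff_sran by (metis sinv_mult sinv_idempotent is_idempotent_sran)
  then show ?thesis unfolding natural_le_def using mult_idempotent_right is_idempotent_sran by metis
qed

lemma natural_le_sinv_iff [simp]:
  "natural_le (sinv t) (sinv s) \<longleftrightarrow> natural_le t (s::'a::inverse_semigroup)"
  using natural_le_sinv[of t s] natural_le_sinv[of "sinv t" "sinv s"] by auto

lemma natural_le_iff_sdom: "natural_le t s \<longleftrightarrow> t = s * sdom (t::'a::inverse_semigroup)"
proof -
  have "natural_le t s \<longleftrightarrow> sinv t = sdom t * sinv s"
    using natural_le_iff_sran[of "sinv t" "sinv s"] by simp
  also have "\<dots> \<longleftrightarrow> t = s * sdom t"
  proof -
    have "sinv (s * sdom t) = sdom t * sinv s" by (simp add: sinv_mult sinv_idempotent)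
    then show ?thesis by (metis sinv_sinv)
  qed
  finally show ?thesis .
qed

lemma natural_le_mult_idempotent:
  assumes "is_idempotent f"
  shows "natural_le (s * f) (s::'a::inverse_semigroup)" "natural_le (f * s) s"
  using mult_idempotent_right[OF assms, of s] assms unfolding natural_le_def by blast+

lemma natural_le_mult_left:
  assumes "natural_le t s"
  shows "natural_le (x * t) (x * (s::'a::inverse_semigroup))"
proof -
  have "x * t = x * s * sdom t"
    using assms by (simp add: natural_le_iff_sdom mult.assoc)
  then show ?thesis by (simp add: natural_le_mult_idempotent)
qed

lemma natural_le_mult_right:
  "natural_le t s \<Longrightarrow> natural_le (t * x) (s * (x::'a::inverse_semigroup))"
  unfolding natural_le_def by (metis mult.assoc)

lemma sdom_mult_idempotent:
  assumes f: "is_idempotent f"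
  shows "sdom (v * f) = sdom v * (f::'a::inverse_semigroup)"
proof -
  have "sdom (v * f) = f * (sdom v * f)"
    by (simp add: sdom_def sinv_mult sinv_idempotent[OF f] mult.assoc)
  also have "sdom v * f = f * sdom v"
    by (rule idempotent_commute[OF is_idempotent_sdom f])
  also have "f * (f * sdom v) = f * sdom v"
    using f by (simp add: is_idempotent_def flip: mult.assoc)
  also have "\<dots> = sdom v * f"
    by (rule idempotent_commute[OF f is_idempotent_sdom])
  finally show ?thesis .
qed

lemma sdom_mono: "natural_le t s \<Longrightarrow> sdom s * sdom t = sdom (t::'a::inverse_semigroup)"
  using sdom_mult_idempotent[of "sdom t" s] by (simp add: natural_le_iff_sdom)

lemma sran_mono: "natural_le t s \<Longrightarrow> sran s * sran t = sran (t::'a::inverse_semigroup)"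
  using sdom_mono[of "sinv t" "sinv s"] by simp

lemma sran_absorbs_left: "sran s * (s * t) = s * (t::'a::inverse_semigroup)"
  by (simp flip: mult.assoc)

text \<open>Left translation by \<open>s\<close> is injective on the elements whose range lies below \<open>sdom s\<close>, and an
  element below \<open>s * v\<close> is the translate of one below \<open>v\<close>. Together with its mirror image this is
  what makes translations act on the groupoid basis.\<close>

lemma bij_betw_left_translation:
  fixes s v :: "'a::inverse_semigroup"
  shows "bij_betw (\<lambda>w. s * w) {w. natural_le w v \<and> sdom s * w = w} {u. natural_le u (s * v)}"
proof (rule bij_betw_byWitness[where f' = "\<lambda>u. sinv s * u"])
  show "\<forall>a\<in>{w. natural_le w v \<and> sdom s * w = w}. sinv s * (s * a) = a"
    by (auto simp: sdom_def mult.assoc)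
  have sr: "sran s * u = u" if "natural_le u (s * v)" for u
    using that by (metis natural_le_iff_sdom mult.assoc sran_absorbs_left)
  then show "\<forall>a'\<in>{u. natural_le u (s * v)}. s * (sinv s * a') = a'"
    by (auto simp: sran_def mult.assoc)
  show "(\<lambda>w. s * w) ` {w. natural_le w v \<and> sdom s * w = w} \<subseteq> {u. natural_le u (s * v)}"
    by (auto intro: natural_le_mult_left)
  have "natural_le (sinv s * u) v" if "natural_le u (s * v)" for u
  proof -
    have "natural_le (sinv s * u) (sdom s * v)"
      using natural_le_mult_left[OF that, of "sinv s"] by (simp add: sdom_def mult.assoc)
    then show ?thesis
      using natural_le_trans natural_le_mult_idempotent(2) is_idempotent_sdom by blast
  qed
  then show "(\<lambda>u. sinv s * u) ` {u. natural_le u (s * v)} \<subseteq> {w. natural_le w v \<and> sdom s * w = w}"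
    by (auto simp: sdom_def mult.assoc)
qed

lemma bij_betw_right_translation:
  fixes s v :: "'a::inverse_semigroup"
  shows "bij_betw (\<lambda>w. w * s) {w. natural_le w v \<and> w * sran s = w} {u. natural_le u (v * s)}"
proof (rule bij_betw_byWitness[where f' = "\<lambda>u. u * sinv s"])
  show "\<forall>a\<in>{w. natural_le w v \<and> w * sran s = w}. a * s * sinv s = a"
    by (auto simp: sran_def mult.assoc)
  have sr: "u * sdom s = u" if "natural_le u (v * s)" for u
    using that by (metis natural_le_iff_sran mult.assoc mult_sdom_self)
  then show "\<forall>a'\<in>{u. natural_le u (v * s)}. a' * sinv s * s = a'"
    by (auto simp: sdom_def mult.assoc)
  show "(\<lambda>w. w * s) ` {w. natural_le w v \<and> w * sran s = w} \<subseteq> {u. natural_le u (v * s)}"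
    by (auto intro: natural_le_mult_right)
  have "natural_le (u * sinv s) v" if "natural_le u (v * s)" for u
  proof -
    have "natural_le (u * sinv s) (v * sran s)"
      using natural_le_mult_right[OF that, of "sinv s"] by (simp add: sran_def mult.assoc)
    then show ?thesis
      using natural_le_trans natural_le_mult_idempotent(1) is_idempotent_sran by blast
  qed
  then show "(\<lambda>u. u * sinv s) ` {u. natural_le u (v * s)} \<subseteq> {w. natural_le w v \<and> w * sran s = w}"
    by (auto simp: sran_def mult.assoc)
qed

section \<open>Arrows of the underlying groupoid\<close>

text \<open>Each \<open>x\<close> is regarded as an arrow from the idempotent \<open>sdom x\<close> to the idempotent \<open>sran x\<close>. When
  \<open>sdom x = sran y\<close>, the product \<open>x * y\<close> is the composite arrow.\<close>

definition arrows :: "'a::inverse_semigroup \<Rightarrow> 'a \<Rightarrow> 'a set" where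
  "arrows e f = {x. sdom x = e \<and> sran x = f}"

lemma sdom_mult_arrow: "sdom x = sran y \<Longrightarrow> sdom (x * y) = sdom (y::'a::inverse_semigroup)"
  by (simp add: sdom_def sran_def sinv_mult mult.assoc) (metis mult.assoc sinv_assoc(1) sinv_props(1))

lemma sran_mult_arrow: "sdom x = sran y \<Longrightarrow> sran (x * y) = sran (x::'a::inverse_semigroup)"
  using sdom_mult_arrow[of "sinv y" "sinv x"] by (simp add: sinv_mult flip: sdom_sinv)

text \<open>Composition with an arrow is a bijection, undone by composition with its inverse. Thus
  the number of arrows between two idempotents depends only on their \<open>\<D>\<close>-class.\<close>

lemma card_arrows_left:
  assumes y: "y \<in> arrows f f'"
  shows "card (arrows e f) = card (arrows e (f'::'a::inverse_semigroup))"
proof (rule bij_betw_same_card[of "\<lambda>x. y * x"], rule bij_betw_byWitness[where f' = "\<lambda>x. sinv y * x"])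
  have y: "sdom y = f" "sran y = f'" using y by (auto simp: arrows_def)
  show "\<forall>a\<in>arrows e f. sinv y * (y * a) = a" "\<forall>a\<in>arrows e f'. y * (sinv y * a) = a"
    using y by (auto simp: arrows_def sdom_def sran_def simp flip: mult.assoc)
       (metis mult.assoc sinv_assoc(1))+
  show "(\<lambda>x. y * x) ` arrows e f \<subseteq> arrows e f'" "(\<lambda>x. sinv y * x) ` arrows e f' \<subseteq> arrows e f"
    using y by (auto simp: arrows_def sdom_mult_arrow sran_mult_arrow)
qed

lemma card_arrows_swap: "card (arrows e f) = card (arrows f (e::'a::inverse_semigroup))"
  by (rule bij_betw_same_card[of sinv], rule bij_betw_byWitness[where f' = sinv])
    (auto simp: arrows_def)

lemma card_arrows_right:
  "y \<in> arrows f f' \<Longrightarrow> card (arrows f e) = card (arrows f' (e::'a::inverse_semigroup))"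
  using card_arrows_left[of y f f' e] card_arrows_swap by metis

definition arrows_onto :: "'a::inverse_semigroup \<Rightarrow> nat" where
  "arrows_onto e = card {x. sran x = e}"

lemma arrows_onto_eq_if_arrow:
  assumes y: "y \<in> arrows f (f'::'a::inverse_semigroup)"
  shows "arrows_onto f = arrows_onto f'"
  unfolding arrows_onto_def
proof (rule bij_betw_same_card[of "\<lambda>x. y * x"], rule bij_betw_byWitness[where f' = "\<lambda>x. sinv y * x"])
  have y: "sdom y = f" "sran y = f'" using y by (auto simp: arrows_def)
  show "\<forall>a\<in>{x. sran x = f}. sinv y * (y * a) = a" "\<forall>a\<in>{x. sran x = f'}. y * (sinv y * a) = a"
    using y by (auto simp: sdom_def sran_def simp flip: mult.assoc)
       (metis mult.assoc sinv_assoc(1))+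
  show "(\<lambda>x. y * x) ` {x. sran x = f} \<subseteq> {x. sran x = f'}"
       "(\<lambda>x. sinv y * x) ` {x. sran x = f'} \<subseteq> {x. sran x = f}"
    using y by (auto simp: sran_mult_arrow)
qed

lemma arrows_onto_pos: "is_idempotent e \<Longrightarrow> arrows_onto (e::'a::{finite,inverse_semigroup}) > 0"
  unfolding arrows_onto_def by (auto simp: card_gt_0_iff intro: sran_idempotent)

lemma card_same_sdom: "card {x. sdom x = e} = arrows_onto (e::'a::inverse_semigroup)"
  unfolding arrows_onto_def
  by (rule bij_betw_same_card[of sinv], rule bij_betw_byWitness[where f' = sinv]) auto

text \<open>The arrows into \<open>sran t\<close> are sorted by their source. The possible sources are the idempotents of
  the \<open>\<D>\<close>-class, and the arrows from each of them are as many as the elements of a maximal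
  subgroup. This rewrites the denominator of the inversion formula as a single count.\<close>

lemma arrows_onto_sran:
  assumes \<epsilon>: "is_idempotent \<epsilon>" "\<epsilon> \<in> D_class (t::'a::{finite,inverse_semigroup})"
  shows "arrows_onto (sran t) = num_idempotents t * card (maximal_subgroup \<epsilon>)"
proof -
  let ?I = "{e \<in> D_class t. is_idempotent e}"
  have I: "e \<in> ?I \<longleftrightarrow> (\<exists>x. sdom x = e \<and> sran x = sran t)" for e
    by (auto simp: D_class_def D_rel_def sran_idempotent)
  obtain z where z: "z \<in> arrows \<epsilon> (sran t)"
    using \<epsilon> by (auto simp: D_class_def D_rel_def sran_idempotent arrows_def)
  have G: "maximal_subgroup \<epsilon> = arrows \<epsilon> \<epsilon>" by (simp add: maximal_subgroup_def arrows_def)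
  have "card (arrows e (sran t)) = card (maximal_subgroup \<epsilon>)" if "e \<in> ?I" for e
  proof -
    have "\<exists>x. sdom x = e \<and> sran x = sran t" using that by (rule iffD1[OF I])
    then obtain x where x: "x \<in> arrows e (sran t)" unfolding arrows_def by blast
    have "card (arrows e (sran t)) = card (arrows (sran t) (sran t))"
      by (rule card_arrows_right[OF x])
    also have "\<dots> = card (arrows \<epsilon> (sran t))" by (rule card_arrows_right[OF z, symmetric])
    also have "\<dots> = card (arrows \<epsilon> \<epsilon>)" by (rule card_arrows_left[OF z, symmetric])
    finally show ?thesis by (simp add: G)
  qed
  moreover have "{x. sran x = sran t} = (\<Union>e\<in>?I. arrows e (sran t))"
    unfolding arrows_def using I by blast
  moreover have "card (\<Union>e\<in>?I. arrows e (sran t)) = (\<Sum>e\<in>?I. card (arrows e (sran t)))"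
    by (rule card_UN_disjoint) (auto simp: arrows_def)
  ultimately show ?thesis by (simp add: arrows_onto_def num_idempotents_def)
qed

section \<open>Moebius transforms and the groupoid basis\<close>

text \<open>For \<open>F\<close> extended linearly to the semigroup algebra, this is the value of \<open>F\<close> at the groupoid
  basis element \<open>\<lfloor>t\<rfloor>\<close>.\<close>

definition moebius_transform :: "('a::{finite,inverse_semigroup} \<Rightarrow> complex) \<Rightarrow> 'a \<Rightarrow> complex" where
  "moebius_transform F t = (\<Sum>v | natural_le v t. of_int (moebius v t) * F v)"

lemma sum_moebius_interval:
  fixes s u :: "'a::{finite,inverse_semigroup}"
  shows "(\<Sum>t | natural_le s t \<and> natural_le t u. moebius s t) = (if s = u then 1 else 0)"
proof (cases "natural_le s u")
  case False
  then show ?thesis using natural_le_trans natural_le_refl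
    by (metis (mono_tags, lifting) empty_Collect_eq sum.empty)
next
  case le: True
  show ?thesis
  proof (cases "s = u")
    case True
    then have "{t. natural_le s t \<and> natural_le t u} = {s}"
      using natural_le_antisym natural_le_refl by blast
    then show ?thesis using True by (simp add: moebius.simps)
  next
    case False
    have "{t. natural_le s t \<and> natural_le t u} = insert u {t. natural_le s t \<and> natural_le t u \<and> t \<noteq> u}"
      using le natural_le_refl by blast
    then show ?thesis using False le by (simp add: moebius.simps[of s u])
  qed
qed

lemma sum_moebius_transform:
  "(\<Sum>w | natural_le w v. moebius_transform F w) = F v"
proof -
  have "(\<Sum>w | natural_le w v. moebius_transform F w)
      = (\<Sum>w | natural_le w v. \<Sum>u | natural_le u v.
           (if natural_le u w then of_int (moebius u w) * F u else 0))"
    unfolding moebius_transform_def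
  proof (rule sum.cong[OF refl])
    fix w assume w: "w \<in> {w. natural_le w v}"
    then have "{u. natural_le u w} \<subseteq> {u. natural_le u v}" using natural_le_trans by blast
    then show "(\<Sum>u | natural_le u w. of_int (moebius u w) * F u) =
      (\<Sum>u | natural_le u v. if natural_le u w then of_int (moebius u w) * F u else 0)"
      by (intro sum.mono_neutral_cong_left) auto
  qed
  also have "\<dots> = (\<Sum>u | natural_le u v. \<Sum>w | natural_le w v.
           (if natural_le u w then of_int (moebius u w) * F u else 0))"
    by (rule sum.swap)
  also have "\<dots> = (\<Sum>u | natural_le u v. of_int (\<Sum>w | natural_le u w \<and> natural_le w v. moebius u w) * F u)"
  proof (rule sum.cong[OF refl])
    fix u
    have "(\<Sum>w | natural_le w v. (if natural_le u w then of_int (moebius u w) * F u else 0))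
      = (\<Sum>w | natural_le u w \<and> natural_le w v. of_int (moebius u w) * F u)"
      by (rule sum.mono_neutral_cong_right) auto
    then show "(\<Sum>w | natural_le w v. (if natural_le u w then of_int (moebius u w) * F u else 0))
      = of_int (\<Sum>w | natural_le u w \<and> natural_le w v. moebius u w) * F u"
      by (simp add: sum_distrib_right)
  qed
  also have "\<dots> = (\<Sum>u | natural_le u v. if u = v then F u else 0)"
    unfolding sum_moebius_interval by (rule sum.cong) auto
  also have "\<dots> = F v" by (simp add: sum.delta natural_le_refl)
  finally show ?thesis .
qed

text \<open>A function is determined by its sums over down-sets. The Moebius transforms below are
  evaluated by guessing the answer and summing it over a down-set, so that values of the Moebius
  function never have to be compared.\<close>

lemma moebius_transform_unique:
  assumes h: "\<And>v. (\<Sum>w | natural_le w v. h w) = F v"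
  shows "moebius_transform F t = h t"
proof (induction "card {w. natural_le w t}" arbitrary: t rule: less_induct)
  case less
  have I: "moebius_transform F w = h w" if "w \<in> {w. natural_le w t} - {t}" for w
  proof (rule less)
    have "{x. natural_le x w} \<subset> {x. natural_le x t}"
      using that natural_le_trans natural_le_antisym natural_le_refl by blast
    then show "card {x. natural_le x w} < card {x. natural_le x t}" by (simp add: psubset_card_mono)
  qed
  have "(\<Sum>w\<in>{w. natural_le w t}. moebius_transform F w) = (\<Sum>w\<in>{w. natural_le w t}. h w)"
    using h sum_moebius_transform by metis
  then show ?case
    using sum.cong[OF refl I, of "{w. natural_le w t} - {t}"]
    by (simp add: sum.remove[of "{w. natural_le w t}" t] natural_le_refl)
qed

text \<open>In the algebra: \<open>s \<lfloor>t\<rfloor> = \<lfloor>s t\<rfloor>\<close> if the range of \<open>t\<close> lies below the domain of \<open>s\<close>, and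
  \<open>s \<lfloor>t\<rfloor> = 0\<close> otherwise.\<close>

lemma moebius_transform_left_translate:
  fixes s :: "'a::{finite,inverse_semigroup}"
  shows "moebius_transform (\<lambda>v. G (s * v)) t =
    (if sdom s * t = t then moebius_transform G (s * t) else 0)"
proof (rule moebius_transform_unique)
  fix v
  have "(\<Sum>w | natural_le w v. if sdom s * w = w then moebius_transform G (s * w) else 0)
    = (\<Sum>w | natural_le w v \<and> sdom s * w = w. moebius_transform G (s * w))"
    by (rule sum.mono_neutral_cong_right) auto
  also have "\<dots> = (\<Sum>u | natural_le u (s * v). moebius_transform G u)"
    by (rule sum.reindex_bij_betw[OF bij_betw_left_translation])
  finally show "(\<Sum>w | natural_le w v. if sdom s * w = w then moebius_transform G (s * w) else 0)
    = G (s * v)" by (simp add: sum_moebius_transform)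
qed

lemma moebius_transform_right_translate:
  fixes s :: "'a::{finite,inverse_semigroup}"
  shows "moebius_transform (\<lambda>v. G (v * s)) t =
    (if t * sran s = t then moebius_transform G (t * s) else 0)"
proof (rule moebius_transform_unique)
  fix v
  have "(\<Sum>w | natural_le w v. if w * sran s = w then moebius_transform G (w * s) else 0)
    = (\<Sum>w | natural_le w v \<and> w * sran s = w. moebius_transform G (w * s))"
    by (rule sum.mono_neutral_cong_right) auto
  also have "\<dots> = (\<Sum>u | natural_le u (v * s). moebius_transform G u)"
    by (rule sum.reindex_bij_betw[OF bij_betw_right_translation])
  finally show "(\<Sum>w | natural_le w v. if w * sran s = w then moebius_transform G (w * s) else 0)
    = G (v * s)" by (simp add: sum_moebius_transform)
qed

text \<open>Being fixed by \<open>sdom v\<close> depends on \<open>y\<close> only through its range; the condition says that \<open>sran y\<close>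
  lies below \<open>sdom v\<close>.\<close>

lemma sdom_mult_sran: "sdom v * y = y \<longleftrightarrow> sdom v * sran y = sran (y::'a::inverse_semigroup)"
  by (metis mult.assoc sran_def sran_mult_self)

text \<open>In the algebra: \<open>\<lfloor>x\<rfloor> \<lfloor>y\<rfloor> = \<lfloor>x y\<rfloor>\<close> if \<open>x\<close> and \<open>y\<close> are composable, and \<open>0\<close> otherwise. Below \<open>v\<close>
  there is at most one element with domain \<open>sran y\<close>, the restriction \<open>v * sran y\<close>, and it exists
  exactly when \<open>sran y\<close> lies below \<open>sdom v\<close>.\<close>

lemma moebius_transform_product:
  fixes x y :: "'a::{finite,inverse_semigroup}"
  shows "moebius_transform (\<lambda>v. moebius_transform (\<lambda>w. G (v * w)) y) x =
    (if sdom x = sran y then moebius_transform G (x * y) else 0)"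
proof (rule moebius_transform_unique)
  fix v
  have sub: "w = v * sran y" if "natural_le w v" "sdom w = sran y" for w
    using that natural_le_iff_sdom by metis
  have "(\<Sum>w | natural_le w v. if sdom w = sran y then moebius_transform G (w * y) else 0)
    = (if sdom v * y = y then moebius_transform G (v * y) else 0)"
  proof (cases "sdom v * y = y")
    case True
    let ?w = "v * sran y"
    have w: "natural_le ?w v" by (simp add: natural_le_mult_idempotent)
    have "sdom ?w = sran y"
      using iffD1[OF sdom_mult_sran True] by (simp add: sdom_mult_idempotent)
    then have "natural_le w v \<and> sdom w = sran y \<longleftrightarrow> w = ?w" for w
      using w sub by blast
    then have "{w. natural_le w v \<and> sdom w = sran y} = {?w}" by blast
    moreover have "(\<Sum>w | natural_le w v. if sdom w = sran y then moebius_transform G (w * y) else 0)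
      = (\<Sum>w | natural_le w v \<and> sdom w = sran y. moebius_transform G (w * y))"
      by (rule sum.mono_neutral_cong_right) auto
    ultimately have "(\<Sum>w | natural_le w v. if sdom w = sran y then moebius_transform G (w * y) else 0)
      = moebius_transform G (?w * y)" by simp
    then show ?thesis using True by (simp add: mult.assoc)
  next
    case False
    have "\<not> (natural_le w v \<and> sdom w = sran y)" for w
      using False sdom_mono[of w v] sdom_mult_sran by metis
    then have "(\<Sum>w | natural_le w v. if sdom w = sran y then moebius_transform G (w * y) else 0) = 0"
      by (intro sum.neutral) simp
    then show ?thesis by (simp only: False if_False)
  qed
  then show "(\<Sum>w | natural_le w v. if sdom w = sran y then moebius_transform G (w * y) else 0)
    = moebius_transform (\<lambda>w. G (v * w)) y"
    by (simp add: moebius_transform_left_translate)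
qed

lemma moebius_transform_sum:
  "moebius_transform (\<lambda>v. \<Sum>k\<in>K. c k * F k v) t = (\<Sum>k\<in>K. c k * moebius_transform (F k) t)"
  unfolding moebius_transform_def sum_distrib_left
  by (subst sum.swap) (simp add: algebra_simps)

lemma moebius_inversion_upward:
  fixes a :: "'a::{finite,inverse_semigroup} \<Rightarrow> complex"
  shows "(\<Sum>t | natural_le s t. of_int (moebius s t) * (\<Sum>u | natural_le t u. a u)) = a s"
proof -
  have "(\<Sum>t | natural_le s t. of_int (moebius s t) * (\<Sum>u | natural_le t u. a u))
    = (\<Sum>t | natural_le s t. \<Sum>u\<in>UNIV. if natural_le t u then of_int (moebius s t) * a u else 0)"
    by (rule sum.cong[OF refl]) (simp add: sum_distrib_left sum.If_cases)
  also have "\<dots> = (\<Sum>u\<in>UNIV. \<Sum>t | natural_le s t. if natural_le t u then of_int (moebius s t) * a u else 0)"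
    by (rule sum.swap)
  also have "\<dots> = (\<Sum>u\<in>UNIV. of_int (\<Sum>t | natural_le s t \<and> natural_le t u. moebius s t) * a u)"
    by (rule sum.cong[OF refl]) (simp add: sum_distrib_right sum.If_cases Collect_conj_eq)
  also have "\<dots> = (\<Sum>u\<in>UNIV. if s = u then a u else 0)"
    unfolding sum_moebius_interval by (rule sum.cong) auto
  also have "\<dots> = a s" by simp
  finally show ?thesis .
qed

text \<open>The element with groupoid coefficients \<open>F\<close> has the value \<open>(\<Sum>t. F(t) G\<lfloor>t\<rfloor>)\<close> under a linear
  functional \<open>G\<close>.\<close>

lemma sum_moebius_swap:
  fixes F G :: "'a::{finite,inverse_semigroup} \<Rightarrow> complex"
  shows "(\<Sum>s\<in>UNIV. (\<Sum>t | natural_le s t. of_int (moebius s t) * F t) * G s)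
    = (\<Sum>t\<in>UNIV. F t * moebius_transform G t)"
proof -
  have "(\<Sum>s\<in>UNIV. (\<Sum>t | natural_le s t. of_int (moebius s t) * F t) * G s)
    = (\<Sum>s\<in>UNIV. \<Sum>t\<in>UNIV. if natural_le s t then of_int (moebius s t) * F t * G s else 0)"
    by (rule sum.cong[OF refl]) (simp add: sum_distrib_right sum.If_cases)
  also have "\<dots> = (\<Sum>t\<in>UNIV. \<Sum>s\<in>UNIV. if natural_le s t then of_int (moebius s t) * F t * G s else 0)"
    by (rule sum.swap)
  also have "\<dots> = (\<Sum>t\<in>UNIV. F t * moebius_transform G t)"
    unfolding moebius_transform_def
    by (rule sum.cong[OF refl]) (simp add: sum_distrib_left sum.If_cases algebra_simps)
  finally show ?thesis .
qed

section \<open>The character of the regular action\<close>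

text \<open>The trace of \<open>s\<close> in the action by partial bijections \<open>y \<mapsto> s * y\<close>, defined for \<open>sdom s * y = y\<close>.
  A fixed point satisfies this condition by itself.\<close>

definition fixed_arrows :: "'a::inverse_semigroup \<Rightarrow> nat" where
  "fixed_arrows s = card {y. s * y = y}"

lemma fixes_iff: "s * y = y \<longleftrightarrow> natural_le (sran y) (s::'a::inverse_semigroup)"
proof
  assume "s * y = y"
  then have "sran y = s * sran y" by (simp add: sran_def flip: mult.assoc)
  then show "natural_le (sran y) s"
    by (metis natural_le_mult_idempotent(1) is_idempotent_sran)
next
  assume "natural_le (sran y) s"
  then have "sran y = s * sran y"
    unfolding natural_le_iff_sdom by (simp add: sdom_idempotent)
  then show "s * y = y" by (metis mult.assoc sran_mult_self)
qed

text \<open>The fixed points of \<open>s\<close> are the arrows into the idempotents below \<open>s\<close>. Hence only identity arrows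
  of the groupoid have a nonzero trace.\<close>

lemma moebius_transform_fixed_arrows:
  "moebius_transform (\<lambda>s. of_nat (fixed_arrows s)) t =
    (if is_idempotent t then of_nat (arrows_onto t) else 0)"
proof (rule moebius_transform_unique)
  fix v :: 'a
  let ?E = "{e. natural_le e v \<and> is_idempotent e}"
  have "{y. v * y = y} = (\<Union>e\<in>?E. {y. sran y = e})"
    by (auto simp: fixes_iff)
  moreover have "card (\<Union>e\<in>?E. {y. sran y = e}) = (\<Sum>e\<in>?E. card {y. sran y = e})"
    by (rule card_UN_disjoint) auto
  ultimately have "fixed_arrows v = (\<Sum>e\<in>?E. arrows_onto e)"
    by (simp add: fixed_arrows_def arrows_onto_def)
  moreover have "(\<Sum>w | natural_le w v. if is_idempotent w then of_nat (arrows_onto w) else 0)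
    = (\<Sum>w\<in>?E. complex_of_nat (arrows_onto w))"
    by (rule sum.mono_neutral_cong_right) auto
  ultimately show "(\<Sum>w | natural_le w v. if is_idempotent w then of_nat (arrows_onto w) else 0)
    = complex_of_nat (fixed_arrows v)" by simp
qed

text \<open>The left-hand side says that \<open>s \<lfloor>t\<^sup>-\<^sup>1\<rfloor>\<close> is a nonzero basis element at an identity arrow. It
  means that \<open>s\<close> extends \<open>t\<close>, since \<open>s * sinv t\<close> is then \<open>sran t\<close>.\<close>

lemma idempotent_quotient_iff:
  "sdom s * sinv t = sinv t \<and> is_idempotent (s * sinv t) \<longleftrightarrow> natural_le t (s::'a::inverse_semigroup)"
proof
  assume "natural_le t s"
  then have t: "t = s * sdom t" and d: "sdom s * sdom t = sdom t"
    by (simp_all add: natural_le_iff_sdom sdom_mono)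
  have "s * sinv t = sran t"
    using arg_cong[OF t, of "\<lambda>z. z * sinv t"] by (simp add: sran_def sdom_def mult.assoc)
  moreover have "sdom s * sinv t = sinv t"
    using sdom_mult_sran[of s "sinv t"] d by simp
  ultimately show "sdom s * sinv t = sinv t \<and> is_idempotent (s * sinv t)" by simp
next
  assume *: "sdom s * sinv t = sinv t \<and> is_idempotent (s * sinv t)"
  have e: "sinv (s * sinv t) = s * sinv t" using * sinv_idempotent by blast
  have d: "sdom s * sdom t = sdom t" using * sdom_mult_sran[of s "sinv t"] by simp
  have "s * sinv t = sdom (s * sinv t)" using * by (simp add: sdom_idempotent)
  also have "\<dots> = t * (sdom s * sinv t)" by (simp add: sdom_def sinv_mult mult.assoc)
  also have "\<dots> = sran t" using * by (simp add: sran_def)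
  finally have "s * sdom t = t" by (metis sdom_def mult.assoc sran_mult_self)
  then show "natural_le t s" unfolding natural_le_iff_sdom by simp
qed

text \<open>The trace of \<open>a \<lfloor>t\<^sup>-\<^sup>1\<rfloor>\<close> in the action by partial bijections reads off the coefficient of \<open>a\<close>
  at \<open>\<lfloor>t\<rfloor>\<close>.\<close>

lemma sum_fixed_arrows_transform:
  fixes a :: "'a::{finite,inverse_semigroup} \<Rightarrow> complex"
  shows "(\<Sum>s\<in>UNIV. a s * moebius_transform (\<lambda>v. of_nat (fixed_arrows (s * v))) (sinv t))
    = of_nat (arrows_onto (sran t)) * (\<Sum>s | natural_le t s. a s)"
proof -
  have key: "moebius_transform (\<lambda>v. of_nat (fixed_arrows (s * v))) (sinv t)
    = (if natural_le t s then of_nat (arrows_onto (sran t)) else 0)" for s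
  proof -
    have "s * sinv t = sran t" if "natural_le t s"
    proof -
      have "t = s * sdom t" using that by (simp add: natural_le_iff_sdom)
      from arg_cong[OF this, of "\<lambda>z. z * sinv t"] show ?thesis
        by (simp add: sran_def sdom_def mult.assoc)
    qed
    then show ?thesis
      unfolding moebius_transform_left_translate[of "\<lambda>u. of_nat (fixed_arrows u)" s "sinv t"]
        moebius_transform_fixed_arrows
      using idempotent_quotient_iff[of s t] by auto
  qed
  have "(\<Sum>s\<in>UNIV. a s * moebius_transform (\<lambda>v. of_nat (fixed_arrows (s * v))) (sinv t))
    = (\<Sum>s\<in>UNIV. if natural_le t s then of_nat (arrows_onto (sran t)) * a s else 0)"
    by (intro sum.cong refl) (simp add: key)
  then show ?thesis by (simp add: sum.If_cases sum_distrib_left)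
qed

section \<open>Representations and their matrix coefficients\<close>

definition matrix_coeff :: "'a mat_rep \<Rightarrow> nat \<Rightarrow> nat \<Rightarrow> 'a \<Rightarrow> complex" where
  "matrix_coeff \<rho> i j s = \<rho> (alg_basis s) $$ (i, j)"

lemma rep_carrier: "is_rep \<rho> \<Longrightarrow> \<rho> f \<in> carrier_mat (rep_dim \<rho>) (rep_dim \<rho>)"
  and rep_add: "is_rep \<rho> \<Longrightarrow> \<rho> (\<lambda>s. f s + g s) = \<rho> f + \<rho> g"
  and rep_smult: "is_rep \<rho> \<Longrightarrow> \<rho> (\<lambda>s. c * f s) = c \<cdot>\<^sub>m \<rho> f"
  and rep_mult: "is_rep \<rho> \<Longrightarrow> \<rho> (alg_mult f g) = \<rho> f * \<rho> g"
  unfolding is_rep_def by blast+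

lemma rep_entry:
  fixes \<rho> :: "'a::{finite,semigroup_mult} mat_rep"
  assumes \<rho>: "is_rep \<rho>" and ij: "i < rep_dim \<rho>" "j < rep_dim \<rho>"
  shows "\<rho> f $$ (i, j) = (\<Sum>s\<in>UNIV. f s * matrix_coeff \<rho> i j s)"
proof -
  have "\<rho> (\<lambda>u. if u \<in> A then f u else 0) $$ (i, j) = (\<Sum>s\<in>A. f s * matrix_coeff \<rho> i j s)"
    if "finite A" for A
    using that
  proof induction
    case empty
    have "\<rho> (\<lambda>_. 0) = 0 \<cdot>\<^sub>m \<rho> (\<lambda>_. 0)"
      using rep_smult[OF \<rho>, of 0 "\<lambda>_. 0"] by simp
    from arg_cong[OF this, of "\<lambda>M. M $$ (i, j)"]
    show ?case using rep_carrier[OF \<rho>, of "\<lambda>_. 0"] ij by simp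
  next
    case (insert x A)
    have "(\<lambda>u. if u \<in> insert x A then f u else 0)
        = (\<lambda>u. f x * alg_basis x u + (if u \<in> A then f u else 0))"
      using insert.hyps by (auto simp: alg_basis_def)
    then show ?case
      using insert ij rep_carrier[OF \<rho>, of "alg_basis x"]
        rep_carrier[OF \<rho>, of "\<lambda>u. if u \<in> A then f u else 0"]
      by (simp add: rep_add[OF \<rho>] rep_smult[OF \<rho>] matrix_coeff_def)
  qed
  from this[of UNIV] show ?thesis by simp
qed

text \<open>Evaluating a linear functional on a product of the algebra.\<close>

lemma sum_alg_mult:
  "(\<Sum>u\<in>UNIV. alg_mult f g u * F u) = (\<Sum>x\<in>UNIV. \<Sum>y\<in>UNIV. f x * g y * F (x * y))"
proof -
  have "(\<Sum>u\<in>UNIV. alg_mult f g u * F u)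
    = (\<Sum>u\<in>UNIV. \<Sum>p | fst p * snd p = u. f (fst p) * g (snd p) * F (fst p * snd p))"
    unfolding alg_mult_def
    by (intro sum.cong refl) (simp add: sum_distrib_right case_prod_unfold)
  also have "\<dots> = (\<Sum>p\<in>UNIV. f (fst p) * g (snd p) * F (fst p * snd p))"
    using sum.group[of UNIV UNIV "\<lambda>p. fst p * snd p" "\<lambda>p. f (fst p) * g (snd p) * F (fst p * snd p)"]
    by simp
  also have "\<dots> = (\<Sum>x\<in>UNIV. \<Sum>y\<in>UNIV. f x * g y * F (x * y))"
    by (simp add: sum.cartesian_product case_prod_unfold)
  finally show ?thesis .
qed

lemma sum_alg_basis:
  "(\<Sum>x\<in>UNIV. alg_basis s x * F x) = F (s::'a::finite)"
  by (subst sum.remove[of UNIV s]) (auto simp: alg_basis_def)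

lemma alg_mult_basis: "alg_mult (alg_basis s) (alg_basis t) = alg_basis (s * t)"
proof
  fix u
  have "alg_mult (alg_basis s) (alg_basis t) u
    = (\<Sum>v\<in>UNIV. alg_mult (alg_basis s) (alg_basis t) v * (if v = u then 1 else 0))"
    by (simp add: if_distrib cong: if_cong)
  also have "\<dots> = (\<Sum>x\<in>UNIV. alg_basis s x * (\<Sum>y\<in>UNIV. alg_basis t y * (if x * y = u then 1 else 0)))"
    unfolding sum_alg_mult by (simp add: sum_distrib_left mult.assoc)
  also have "\<dots> = alg_basis (s * t) u"
    unfolding sum_alg_basis by (auto simp: alg_basis_def)
  finally show "alg_mult (alg_basis s) (alg_basis t) u = alg_basis (s * t) u" .
qed

lemma mat_mult_entry:
  assumes "A \<in> carrier_mat n m" "B \<in> carrier_mat m p" "i < n" "j < p"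
  shows "(A * B) $$ (i, j) = (\<Sum>k<m. A $$ (i, k) * B $$ (k, j))"
  using assms by (auto simp: scalar_prod_def atLeast0LessThan intro!: sum.cong)

lemma matrix_coeff_mult:
  fixes \<rho> :: "'a::{finite,semigroup_mult} mat_rep"
  assumes \<rho>: "is_rep \<rho>" and "i < rep_dim \<rho>" "j < rep_dim \<rho>"
  shows "matrix_coeff \<rho> i j (s * t) = (\<Sum>k<rep_dim \<rho>. matrix_coeff \<rho> i k s * matrix_coeff \<rho> k j t)"
  using assms unfolding matrix_coeff_def
  by (simp only: alg_mult_basis[symmetric] rep_mult mat_mult_entry[OF rep_carrier rep_carrier])

text \<open>Converse of taking matrix coefficients; it is used to build subrepresentations, quotients and
  the action by partial bijections.\<close>

definition rep_of_coeffs :: "nat \<Rightarrow> (nat \<Rightarrow> nat \<Rightarrow> 'a \<Rightarrow> complex) \<Rightarrow> 'a::finite mat_rep" where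
  "rep_of_coeffs d m = (\<lambda>f. mat d d (\<lambda>(i, j). \<Sum>s\<in>UNIV. f s * m i j s))"

lemma rep_dim_rep_of_coeffs [simp]: "rep_dim (rep_of_coeffs d m) = d"
  by (simp add: rep_dim_def rep_of_coeffs_def)

lemma is_rep_rep_of_coeffs:
  fixes m :: "nat \<Rightarrow> nat \<Rightarrow> 'a::{finite,semigroup_mult} \<Rightarrow> complex"
  assumes m: "\<And>i j s t. i < d \<Longrightarrow> j < d \<Longrightarrow> m i j (s * t) = (\<Sum>k<d. m i k s * m k j t)"
  shows "is_rep (rep_of_coeffs d m)"
  unfolding is_rep_def rep_dim_rep_of_coeffs
proof (intro conjI allI)
  fix f g :: "'a semigroup_algebra" and c
  show c: "rep_of_coeffs d m f \<in> carrier_mat d d" for f by (simp add: rep_of_coeffs_def)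
  show "rep_of_coeffs d m (\<lambda>s. f s + g s) = rep_of_coeffs d m f + rep_of_coeffs d m g"
    by (rule eq_matI) (simp_all add: rep_of_coeffs_def algebra_simps sum.distrib)
  show "rep_of_coeffs d m (\<lambda>s. c * f s) = c \<cdot>\<^sub>m rep_of_coeffs d m f"
    by (rule eq_matI) (simp_all add: rep_of_coeffs_def algebra_simps sum_distrib_left)
  show "rep_of_coeffs d m (alg_mult f g) = rep_of_coeffs d m f * rep_of_coeffs d m g"
  proof (rule eq_matI)
    fix i j
    assume "i < dim_row (rep_of_coeffs d m f * rep_of_coeffs d m g)"
      "j < dim_col (rep_of_coeffs d m f * rep_of_coeffs d m g)"
    then have ij: "i < d" "j < d" by (simp_all add: rep_of_coeffs_def)
    have "rep_of_coeffs d m (alg_mult f g) $$ (i, j)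
      = (\<Sum>x\<in>UNIV. \<Sum>y\<in>UNIV. \<Sum>k<d. f x * m i k x * (g y * m k j y))"
      using ij by (simp add: rep_of_coeffs_def sum_alg_mult m sum_distrib_left mult.assoc mult.left_commute)
    also have "\<dots> = (\<Sum>x\<in>UNIV. \<Sum>k<d. \<Sum>y\<in>UNIV. f x * m i k x * (g y * m k j y))"
      by (intro sum.cong refl sum.swap)
    also have "\<dots> = (\<Sum>k<d. \<Sum>x\<in>UNIV. \<Sum>y\<in>UNIV. f x * m i k x * (g y * m k j y))"
      by (rule sum.swap)
    also have "\<dots> = (\<Sum>k<d. rep_of_coeffs d m f $$ (i, k) * rep_of_coeffs d m g $$ (k, j))"
      using ij by (simp add: rep_of_coeffs_def sum_product)
    also have "\<dots> = (rep_of_coeffs d m f * rep_of_coeffs d m g) $$ (i, j)"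
      by (rule mat_mult_entry[OF c c ij, symmetric])
    finally show "rep_of_coeffs d m (alg_mult f g) $$ (i, j)
      = (rep_of_coeffs d m f * rep_of_coeffs d m g) $$ (i, j)" .
  qed (simp_all add: rep_of_coeffs_def)
qed

section \<open>Schur's lemma\<close>

lemma subspace_carrier_vec_iff:
  "VectorSpace.subspace class_ring W (module_vec TYPE(complex) n) \<longleftrightarrow>
    W \<subseteq> carrier_vec n \<and> 0\<^sub>v n \<in> W \<and> (\<forall>v\<in>W. \<forall>w\<in>W. v + w \<in> W) \<and> (\<forall>c. \<forall>v\<in>W. c \<cdot>\<^sub>v v \<in> W)"
proof -
  have "vectorspace class_ring (module_vec TYPE(complex) n)"
    "Module.module class_ring (module_vec TYPE(complex) n)"
    by (rule vec_vs, rule vec_module)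
  then show ?thesis
    by (auto simp: VectorSpace.subspace_def submodule_def module_vec_simps class_ring_simps)
qed

lemma irreducible_is_rep: "irreducible_rep \<rho> \<Longrightarrow> is_rep \<rho>"
  unfolding irreducible_rep_def by blast

lemma irreducible_invariant:
  assumes \<rho>: "irreducible_rep \<rho>" and W: "W \<subseteq> carrier_vec (rep_dim \<rho>)" "0\<^sub>v (rep_dim \<rho>) \<in> W"
    "\<And>v w. v \<in> W \<Longrightarrow> w \<in> W \<Longrightarrow> v + w \<in> W" "\<And>c v. v \<in> W \<Longrightarrow> c \<cdot>\<^sub>v v \<in> W"
    "\<And>f w. w \<in> W \<Longrightarrow> \<rho> f *\<^sub>v w \<in> W"
  shows "W = {0\<^sub>v (rep_dim \<rho>)} \<or> W = carrier_vec (rep_dim \<rho>)"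
proof -
  have "invariant_subspace \<rho> W"
    unfolding invariant_subspace_def subspace_carrier_vec_iff using W by blast
  then show ?thesis using \<rho> unfolding irreducible_rep_def by blast
qed

text \<open>Both dimensions are the trace of \<open>C * D\<close> and \<open>D * C\<close>, which agree.\<close>

lemma trace_one_product_dim:
  assumes C: "C \<in> carrier_mat n m" and D: "D \<in> carrier_mat m n"
    and CD: "C * D = 1\<^sub>m n" and DC: "D * C = (1\<^sub>m m :: complex mat)"
  shows "n = m"
proof -
  have "of_nat n = (\<Sum>i<n. (C * D) $$ (i, i))" unfolding CD by simp
  also have "\<dots> = (\<Sum>i<n. \<Sum>k<m. C $$ (i, k) * D $$ (k, i))"
    by (intro sum.cong refl mat_mult_entry[OF C D]) auto
  also have "\<dots> = (\<Sum>k<m. \<Sum>i<n. D $$ (k, i) * C $$ (i, k))"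
    by (subst sum.swap) (simp add: mult.commute)
  also have "\<dots> = (\<Sum>k<m. (D * C) $$ (k, k))"
    by (intro sum.cong refl mat_mult_entry[OF D C, symmetric]) auto
  also have "\<dots> = complex_of_nat m" unfolding DC by simp
  finally show ?thesis by simp
qed

text \<open>The kernel of an intertwiner is invariant under \<open>\<sigma>\<close> and its image is invariant under \<open>\<rho>\<close>. A
  nonzero intertwiner of irreducible representations is thus injective and surjective. Its inverse
  is assembled from preimages of the unit vectors.\<close>

lemma intertwiner_invertible:
  fixes \<rho> \<sigma> :: "'a::{finite,semigroup_mult} mat_rep"
  assumes \<rho>: "irreducible_rep \<rho>" and \<sigma>: "irreducible_rep \<sigma>"
    and C: "C \<in> carrier_mat (rep_dim \<rho>) (rep_dim \<sigma>)"
    and comm: "\<And>f. \<rho> f * C = C * \<sigma> f"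
    and nz: "C \<noteq> 0\<^sub>m (rep_dim \<rho>) (rep_dim \<sigma>)"
  obtains D where "D \<in> carrier_mat (rep_dim \<sigma>) (rep_dim \<rho>)"
    "C * D = 1\<^sub>m (rep_dim \<rho>)" "D * C = 1\<^sub>m (rep_dim \<sigma>)" "rep_dim \<rho> = rep_dim \<sigma>"
proof -
  let ?n = "rep_dim \<rho>" and ?m = "rep_dim \<sigma>"
  note c\<rho> = rep_carrier[OF irreducible_is_rep[OF \<rho>]]
  note c\<sigma> = rep_carrier[OF irreducible_is_rep[OF \<sigma>]]
  have comm_vec: "\<rho> f *\<^sub>v (C *\<^sub>v v) = C *\<^sub>v (\<sigma> f *\<^sub>v v)" if "v \<in> carrier_vec ?m" for f v
    using that comm[of f] assoc_mult_mat_vec[OF c\<rho> C that] assoc_mult_mat_vec[OF C c\<sigma> that] by metis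
  let ?K = "{v \<in> carrier_vec ?m. C *\<^sub>v v = 0\<^sub>v ?n}"
  have "?K = {0\<^sub>v ?m} \<or> ?K = carrier_vec ?m"
  proof (rule irreducible_invariant[OF \<sigma>])
    show "0\<^sub>v ?m \<in> ?K" using C by auto
    show "v + w \<in> ?K" if "v \<in> ?K" "w \<in> ?K" for v w
      using that C by (auto simp: mult_add_distrib_mat_vec)
    show "k \<cdot>\<^sub>v v \<in> ?K" if "v \<in> ?K" for k v
      using that C by (auto simp: mult_mat_vec)
    show "\<sigma> f *\<^sub>v w \<in> ?K" if "w \<in> ?K" for f w
    proof -
      have w: "w \<in> carrier_vec ?m" "C *\<^sub>v w = 0\<^sub>v ?n" using that by auto
      have "C *\<^sub>v (\<sigma> f *\<^sub>v w) = \<rho> f *\<^sub>v 0\<^sub>v ?n" using comm_vec[OF w(1), of f] w(2) by simp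
      also have "\<dots> = 0\<^sub>v ?n" using c\<rho>[of f] by auto
      finally show ?thesis using c\<sigma>[of f] w by auto
    qed
  qed auto
  moreover have "?K \<noteq> carrier_vec ?m"
  proof
    assume K: "?K = carrier_vec ?m"
    have "C = 0\<^sub>m ?n ?m"
    proof (rule eq_matI)
      fix i j assume ij: "i < dim_row (0\<^sub>m ?n ?m :: complex mat)" "j < dim_col (0\<^sub>m ?n ?m :: complex mat)"
      have "unit_vec ?m j \<in> ?K" unfolding K by simp
      then have "C *\<^sub>v unit_vec ?m j = 0\<^sub>v ?n" by blast
      then have "(C *\<^sub>v unit_vec ?m j) $ i = 0" using ij by simp
      then show "C $$ (i, j) = 0\<^sub>m ?n ?m $$ (i, j)" using ij C by (simp add: scalar_prod_right_unit)
    qed (use C in auto)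
    then show False using nz by simp
  qed
  ultimately have inj: "v = 0\<^sub>v ?m" if "v \<in> carrier_vec ?m" "C *\<^sub>v v = 0\<^sub>v ?n" for v
    using that by blast
  let ?R = "{C *\<^sub>v v | v. v \<in> carrier_vec ?m}"
  have "?R = {0\<^sub>v ?n} \<or> ?R = carrier_vec ?n"
  proof (rule irreducible_invariant[OF \<rho>])
    have "0\<^sub>v ?n = C *\<^sub>v 0\<^sub>v ?m" by (intro eq_vecI) (use C in auto)
    moreover have "0\<^sub>v ?m \<in> carrier_vec ?m" by simp
    ultimately show "0\<^sub>v ?n \<in> ?R" by blast
    show "v + w \<in> ?R" if "v \<in> ?R" "w \<in> ?R" for v w
    proof -
      from that obtain v' w' where v': "v' \<in> carrier_vec ?m" "v = C *\<^sub>v v'"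
        and w': "w' \<in> carrier_vec ?m" "w = C *\<^sub>v w'" by blast
      have "v + w = C *\<^sub>v (v' + w')" unfolding v' w'
        by (rule mult_add_distrib_mat_vec[OF C v'(1) w'(1), symmetric])
      then show ?thesis using add_carrier_vec[OF v'(1) w'(1)] by blast
    qed
    show "k \<cdot>\<^sub>v v \<in> ?R" if "v \<in> ?R" for k v
    proof -
      from that obtain v' where v': "v' \<in> carrier_vec ?m" "v = C *\<^sub>v v'" by blast
      have "k \<cdot>\<^sub>v v = C *\<^sub>v (k \<cdot>\<^sub>v v')" unfolding v'
        by (rule mult_mat_vec[OF C v'(1), symmetric])
      then show ?thesis using smult_carrier_vec[of k v' ?m] v'(1) by blast
    qed
    show "\<rho> f *\<^sub>v w \<in> ?R" if "w \<in> ?R" for f w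
    proof -
      from that obtain w' where w': "w' \<in> carrier_vec ?m" "w = C *\<^sub>v w'" by blast
      have "\<rho> f *\<^sub>v w = C *\<^sub>v (\<sigma> f *\<^sub>v w')" unfolding w' by (rule comm_vec[OF w'(1)])
      moreover have "\<sigma> f *\<^sub>v w' \<in> carrier_vec ?m" using c\<sigma>[of f] w'(1) by simp
      ultimately show ?thesis by blast
    qed
  qed (use C in auto)
  moreover have "?R \<noteq> {0\<^sub>v ?n}"
  proof
    assume R: "?R = {0\<^sub>v ?n}"
    then have "C *\<^sub>v v = 0\<^sub>v ?n" if "v \<in> carrier_vec ?m" for v using that by blast
    then show False using \<open>?K \<noteq> carrier_vec ?m\<close> by blast
  qed
  ultimately have R: "?R = carrier_vec ?n" by (elim disjE) (rule notE)
  have "\<exists>v. v \<in> carrier_vec ?m \<and> C *\<^sub>v v = w" if "w \<in> carrier_vec ?n" for w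
  proof -
    have "w \<in> ?R" unfolding R by (rule that)
    then show ?thesis by blast
  qed
  then obtain g where g: "\<And>w. w \<in> carrier_vec ?n \<Longrightarrow> g w \<in> carrier_vec ?m"
      "\<And>w. w \<in> carrier_vec ?n \<Longrightarrow> C *\<^sub>v g w = w"
    by metis
  define D where "D = mat ?m ?n (\<lambda>(i, j). g (unit_vec ?n j) $ i)"
  have D: "D \<in> carrier_mat ?m ?n" by (simp add: D_def)
  have colD: "col D j = g (unit_vec ?n j)" if "j < ?n" for j
    using that g(1)[of "unit_vec ?n j"] by (auto simp: D_def)
  have CD: "C * D = 1\<^sub>m ?n"
  proof (rule mat_col_eqI)
    fix j assume j: "j < dim_col (1\<^sub>m ?n :: complex mat)"
    then show "col (C * D) j = col (1\<^sub>m ?n) j"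
      using g(2)[of "unit_vec ?n j"] by (simp only: colD col_mult2[OF C D] index_one_mat col_one unit_vec_carrier)
  qed (use C D in auto)
  have DC: "D * C = 1\<^sub>m ?m"
  proof (rule mat_col_eqI)
    fix j assume "j < dim_col (1\<^sub>m ?m :: complex mat)"
    then have j: "j < ?m" by simp
    let ?u = "unit_vec ?m j :: complex vec"
    have cj: "col C j \<in> carrier_vec ?n" by (rule col_carrier_vec[OF j C])
    have Cu: "C *\<^sub>v ?u = col C j"
      using C j by (intro eq_vecI) (simp_all add: scalar_prod_right_unit)
    have "C *\<^sub>v (D *\<^sub>v col C j) = (C * D) *\<^sub>v col C j"
      by (rule assoc_mult_mat_vec[OF C D cj, symmetric])
    then have "C *\<^sub>v (D *\<^sub>v col C j) = C *\<^sub>v ?u" unfolding CD Cu using cj by simp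
    moreover have dv: "D *\<^sub>v col C j \<in> carrier_vec ?m" using D cj by simp
    ultimately have "C *\<^sub>v (D *\<^sub>v col C j - ?u) = 0\<^sub>v ?n"
      using C cj Cu by (simp add: mult_minus_distrib_mat_vec[OF C dv])
    then have diff: "D *\<^sub>v col C j - ?u = 0\<^sub>v ?m" using dv by (intro inj) auto
    have "D *\<^sub>v col C j = ?u"
    proof (rule eq_vecI)
      fix i assume "i < dim_vec ?u"
      then show "(D *\<^sub>v col C j) $ i = ?u $ i"
        using arg_cong[OF diff, of "\<lambda>v. v $ i"] dv by simp
    qed (use D in simp)
    then show "col (D * C) j = col (1\<^sub>m ?m) j" using j by (simp add: col_mult2[OF D C])
  qed (use C D in auto)
  show thesis by (rule that[OF D CD DC trace_one_product_dim[OF C D CD DC]])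
qed

lemma schur_equivalent:
  fixes \<rho> \<sigma> :: "'a::{finite,semigroup_mult} mat_rep"
  assumes \<rho>: "irreducible_rep \<rho>" and \<sigma>: "irreducible_rep \<sigma>"
    and C: "C \<in> carrier_mat (rep_dim \<rho>) (rep_dim \<sigma>)"
    and comm: "\<And>f. \<rho> f * C = C * \<sigma> f"
    and nz: "C \<noteq> 0\<^sub>m (rep_dim \<rho>) (rep_dim \<sigma>)"
  shows "equivalent_rep \<rho> \<sigma>"
proof -
  obtain D where D: "D \<in> carrier_mat (rep_dim \<sigma>) (rep_dim \<rho>)"
    "C * D = 1\<^sub>m (rep_dim \<rho>)" "D * C = 1\<^sub>m (rep_dim \<sigma>)" and d: "rep_dim \<rho> = rep_dim \<sigma>"
    using intertwiner_invertible[OF assms] .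
  note c\<rho> = rep_carrier[OF irreducible_is_rep[OF \<rho>]]
  note c\<sigma> = rep_carrier[OF irreducible_is_rep[OF \<sigma>]]
  have "similar_mat_wit (\<rho> f) (\<sigma> f) C D" for f
  proof (rule similar_mat_witI[where n = "rep_dim \<rho>"])
    have "C * \<sigma> f * D = \<rho> f * C * D" using comm by simp
    also have "\<dots> = \<rho> f * (C * D)" by (rule assoc_mult_mat[OF c\<rho> C D(1)])
    also have "\<dots> = \<rho> f" using D c\<rho>[of f] by simp
    finally show "\<rho> f = C * \<sigma> f * D" by simp
  qed (use D C d c\<rho>[of f] c\<sigma>[of f] in auto)
  then show ?thesis unfolding equivalent_rep_def by blast
qed

lemma irreducible_dim_pos: "irreducible_rep \<rho> \<Longrightarrow> rep_dim \<rho> > 0"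
proof (rule ccontr)
  assume \<rho>: "irreducible_rep \<rho>" and "\<not> rep_dim \<rho> > 0"
  then have "\<rho> f = 0\<^sub>m (rep_dim \<rho>) (rep_dim \<rho>)" for f
    using rep_carrier[OF irreducible_is_rep[OF \<rho>], of f] by (intro eq_matI) auto
  then show False using \<rho> unfolding irreducible_rep_def by blast
qed

text \<open>Over the complex numbers \<open>C\<close> has an eigenvalue \<open>k\<close>, and \<open>C - k\<close> is an intertwiner with a nonzero
  kernel, hence zero.\<close>

lemma schur_scalar:
  fixes \<rho> :: "'a::{finite,semigroup_mult} mat_rep"
  assumes \<rho>: "irreducible_rep \<rho>"
    and C: "C \<in> carrier_mat (rep_dim \<rho>) (rep_dim \<rho>)"
    and comm: "\<And>f. \<rho> f * C = C * \<rho> f"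
  obtains k where "C = k \<cdot>\<^sub>m 1\<^sub>m (rep_dim \<rho>)"
proof -
  let ?n = "rep_dim \<rho>"
  note c\<rho> = rep_carrier[OF irreducible_is_rep[OF \<rho>]]
  obtain k where "eigenvalue C k"
    using spectrum_non_empty[OF C irreducible_dim_pos[OF \<rho>]] unfolding spectrum_def by blast
  then obtain v where v: "v \<in> carrier_vec ?n" "v \<noteq> 0\<^sub>v ?n" "C *\<^sub>v v = k \<cdot>\<^sub>v v"
    using C unfolding eigenvalue_def eigenvector_def by auto
  define E where "E = C - k \<cdot>\<^sub>m 1\<^sub>m ?n"
  have E: "E \<in> carrier_mat ?n ?n" unfolding E_def by (rule minus_carrier_mat) simp
  have commE: "\<rho> f * E = E * \<rho> f" for f
  proof -
    have "\<rho> f * E = \<rho> f * C - \<rho> f * (k \<cdot>\<^sub>m 1\<^sub>m ?n)"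
      unfolding E_def by (rule mult_minus_distrib_mat[OF c\<rho> C]) simp
    also have "\<rho> f * (k \<cdot>\<^sub>m 1\<^sub>m ?n) = (k \<cdot>\<^sub>m 1\<^sub>m ?n) * \<rho> f"
      using mult_smult_distrib[OF c\<rho>, of "1\<^sub>m ?n" ?n f k] mult_smult_assoc_mat[of "1\<^sub>m ?n" ?n ?n "\<rho> f" ?n k]
        c\<rho>[of f] by simp
    also have "\<rho> f * C - (k \<cdot>\<^sub>m 1\<^sub>m ?n) * \<rho> f = E * \<rho> f"
      unfolding E_def comm by (rule minus_mult_distrib_mat[OF C _ c\<rho>, symmetric]) simp
    finally show ?thesis .
  qed
  have Ev: "E *\<^sub>v v = 0\<^sub>v ?n"
  proof -
    have "(k \<cdot>\<^sub>m 1\<^sub>m ?n) *\<^sub>v v = k \<cdot>\<^sub>v v"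
      using v(1) by (intro eq_vecI) (simp_all add: smult_scalar_prod_distrib[OF _ v(1)])
    moreover have "E *\<^sub>v v = C *\<^sub>v v - (k \<cdot>\<^sub>m 1\<^sub>m ?n) *\<^sub>v v"
      unfolding E_def by (rule minus_mult_distrib_mat_vec[OF C _ v(1)]) simp
    ultimately show ?thesis using v by simp
  qed
  have "E = 0\<^sub>m ?n ?n"
  proof (rule ccontr)
    assume "E \<noteq> 0\<^sub>m ?n ?n"
    then obtain D where D: "D \<in> carrier_mat ?n ?n" "D * E = 1\<^sub>m ?n"
      using intertwiner_invertible[OF \<rho> \<rho> E commE] by metis
    have "v = (D * E) *\<^sub>v v" using D v by simp
    also have "\<dots> = D *\<^sub>v (E *\<^sub>v v)" by (rule assoc_mult_mat_vec[OF D(1) E v(1)])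
    also have "\<dots> = 0\<^sub>v ?n" unfolding Ev using D by auto
    finally show False using v by simp
  qed
  then have "C = k \<cdot>\<^sub>m 1\<^sub>m ?n"
  proof -
    assume E0: "E = 0\<^sub>m ?n ?n"
    show ?thesis
    proof (rule eq_matI)
      fix i j assume ij: "i < dim_row (k \<cdot>\<^sub>m 1\<^sub>m ?n)" "j < dim_col (k \<cdot>\<^sub>m 1\<^sub>m ?n)"
      have "E $$ (i, j) = 0" using E0 ij by simp
      then show "C $$ (i, j) = (k \<cdot>\<^sub>m 1\<^sub>m ?n) $$ (i, j)" using ij C by (simp add: E_def)
    qed (use C in auto)
  qed
  then show thesis by (rule that)
qed

text \<open>Schur's lemma is applied below to matrices given by their entries, for which commutation is known
  on the elements of the semigroup only. Linearity extends it to the algebra.\<close>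

lemma intertwines_if_on_basis:
  fixes \<rho> \<sigma> :: "'a::{finite,semigroup_mult} mat_rep"
  assumes \<rho>: "is_rep \<rho>" and \<sigma>: "is_rep \<sigma>"
    and c: "\<And>s i l. i < rep_dim \<rho> \<Longrightarrow> l < rep_dim \<sigma> \<Longrightarrow>
      (\<Sum>k<rep_dim \<rho>. matrix_coeff \<rho> i k s * c k l) = (\<Sum>k<rep_dim \<sigma>. c i k * matrix_coeff \<sigma> k l s)"
  defines "C \<equiv> mat (rep_dim \<rho>) (rep_dim \<sigma>) (\<lambda>(i, l). c i l)"
  shows "\<rho> f * C = C * \<sigma> f"
proof (rule eq_matI)
  let ?n = "rep_dim \<rho>" and ?m = "rep_dim \<sigma>"
  have C: "C \<in> carrier_mat ?n ?m" by (simp add: C_def)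
  note c\<rho> = rep_carrier[OF \<rho>, of f] and c\<sigma> = rep_carrier[OF \<sigma>, of f]
  fix i l assume "i < dim_row (C * \<sigma> f)" "l < dim_col (C * \<sigma> f)"
  then have il: "i < ?n" "l < ?m" using C c\<sigma> by auto
  have "(\<rho> f * C) $$ (i, l) = (\<Sum>k<?n. (\<Sum>s\<in>UNIV. f s * matrix_coeff \<rho> i k s) * c k l)"
    unfolding mat_mult_entry[OF c\<rho> C il]
    by (intro sum.cong refl) (simp add: C_def il rep_entry[OF \<rho>])
  also have "\<dots> = (\<Sum>s\<in>UNIV. f s * (\<Sum>k<?n. matrix_coeff \<rho> i k s * c k l))"
    unfolding sum_distrib_right sum_distrib_left
    by (subst sum.swap) (simp add: mult.assoc)
  also have "\<dots> = (\<Sum>s\<in>UNIV. f s * (\<Sum>k<?m. c i k * matrix_coeff \<sigma> k l s))"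
    using c[OF il] by simp
  also have "\<dots> = (\<Sum>k<?m. c i k * (\<Sum>s\<in>UNIV. f s * matrix_coeff \<sigma> k l s))"
    unfolding sum_distrib_left
    by (subst sum.swap) (simp add: mult.left_commute)
  also have "\<dots> = (C * \<sigma> f) $$ (i, l)"
    unfolding mat_mult_entry[OF C c\<sigma> il]
    by (intro sum.cong refl) (simp add: C_def il rep_entry[OF \<sigma>])
  finally show "(\<rho> f * C) $$ (i, l) = (C * \<sigma> f) $$ (i, l)" .
qed (use rep_carrier[OF \<rho>, of f] rep_carrier[OF \<sigma>, of f] in \<open>auto simp: C_def\<close>)

lemma schur_scalar_coeffs:
  fixes \<rho> :: "'a::{finite,semigroup_mult} mat_rep"
  assumes \<rho>: "irreducible_rep \<rho>"
    and c: "\<And>s i l. i < rep_dim \<rho> \<Longrightarrow> l < rep_dim \<rho> \<Longrightarrow>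
      (\<Sum>k<rep_dim \<rho>. matrix_coeff \<rho> i k s * c k l) = (\<Sum>k<rep_dim \<rho>. c i k * matrix_coeff \<rho> k l s)"
  obtains k where "\<And>i l. i < rep_dim \<rho> \<Longrightarrow> l < rep_dim \<rho> \<Longrightarrow> c i l = (if i = l then k else 0)"
proof -
  let ?n = "rep_dim \<rho>"
  let ?C = "mat ?n ?n (\<lambda>(i, l). c i l)"
  note i\<rho> = irreducible_is_rep[OF \<rho>]
  obtain k where k: "?C = k \<cdot>\<^sub>m 1\<^sub>m ?n"
    by (rule schur_scalar[OF \<rho> mat_carrier intertwines_if_on_basis[OF i\<rho> i\<rho> c]])
  have "c i l = (if i = l then k else 0)" if "i < ?n" "l < ?n" for i l
    using that arg_cong[OF k, of "\<lambda>M. M $$ (i, l)"] by simp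
  then show thesis by (rule that)
qed

lemma schur_zero_coeffs:
  fixes \<rho> \<sigma> :: "'a::{finite,semigroup_mult} mat_rep"
  assumes \<rho>: "irreducible_rep \<rho>" and \<sigma>: "irreducible_rep \<sigma>" and ne: "\<not> equivalent_rep \<rho> \<sigma>"
    and c: "\<And>s i l. i < rep_dim \<rho> \<Longrightarrow> l < rep_dim \<sigma> \<Longrightarrow>
      (\<Sum>k<rep_dim \<rho>. matrix_coeff \<rho> i k s * c k l) = (\<Sum>k<rep_dim \<sigma>. c i k * matrix_coeff \<sigma> k l s)"
    and il: "i < rep_dim \<rho>" "l < rep_dim \<sigma>"
  shows "c i l = 0"
proof -
  let ?C = "mat (rep_dim \<rho>) (rep_dim \<sigma>) (\<lambda>(i, l). c i l)"
  have "?C = 0\<^sub>m (rep_dim \<rho>) (rep_dim \<sigma>)"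
    using schur_equivalent[OF \<rho> \<sigma> mat_carrier
        intertwines_if_on_basis[OF irreducible_is_rep[OF \<rho>] irreducible_is_rep[OF \<sigma>] c]] ne by blast
  from arg_cong[OF this, of "\<lambda>M. M $$ (i, l)"] show ?thesis using il by simp
qed

section \<open>Orthogonality of matrix coefficients\<close>

text \<open>The multiplication rules of the groupoid basis, read in the entries of a representation: the
  three products are \<open>s \<lfloor>t\<rfloor>\<close>, \<open>\<lfloor>t\<rfloor> s\<close> and \<open>\<lfloor>s\<rfloor> \<lfloor>t\<rfloor>\<close>.\<close>

lemma moebius_transform_rep_product:
  fixes \<rho> :: "'a::{finite,inverse_semigroup} mat_rep"
  assumes \<rho>: "is_rep \<rho>" and ij: "i < rep_dim \<rho>" "j < rep_dim \<rho>"
  shows "(\<Sum>k<rep_dim \<rho>. matrix_coeff \<rho> i k s * moebius_transform (matrix_coeff \<rho> k j) t) =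
      (if sdom s * t = t then moebius_transform (matrix_coeff \<rho> i j) (s * t) else 0)"
    and "(\<Sum>k<rep_dim \<rho>. moebius_transform (matrix_coeff \<rho> i k) t * matrix_coeff \<rho> k j s) =
      (if t * sran s = t then moebius_transform (matrix_coeff \<rho> i j) (t * s) else 0)"
    and "(\<Sum>k<rep_dim \<rho>. moebius_transform (matrix_coeff \<rho> i k) s * moebius_transform (matrix_coeff \<rho> k j) t) =
      (if sdom s = sran t then moebius_transform (matrix_coeff \<rho> i j) (s * t) else 0)"
proof -
  have eq: "(\<Sum>k<rep_dim \<rho>. matrix_coeff \<rho> i k s * moebius_transform (matrix_coeff \<rho> k j) t) =
    moebius_transform (\<lambda>v. matrix_coeff \<rho> i j (s * v)) t" for s
    by (simp add: moebius_transform_sum matrix_coeff_mult[OF \<rho> ij])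
  then show "(\<Sum>k<rep_dim \<rho>. matrix_coeff \<rho> i k s * moebius_transform (matrix_coeff \<rho> k j) t) =
      (if sdom s * t = t then moebius_transform (matrix_coeff \<rho> i j) (s * t) else 0)"
    using moebius_transform_left_translate by metis
  have "(\<Sum>k<rep_dim \<rho>. moebius_transform (matrix_coeff \<rho> i k) t * matrix_coeff \<rho> k j s) =
    moebius_transform (\<lambda>v. matrix_coeff \<rho> i j (v * s)) t"
    by (simp add: matrix_coeff_mult[OF \<rho> ij] mult.commute moebius_transform_sum)
  then show "(\<Sum>k<rep_dim \<rho>. moebius_transform (matrix_coeff \<rho> i k) t * matrix_coeff \<rho> k j s) =
      (if t * sran s = t then moebius_transform (matrix_coeff \<rho> i j) (t * s) else 0)"
    using moebius_transform_right_translate by metis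
  have "(\<Sum>k<rep_dim \<rho>. moebius_transform (matrix_coeff \<rho> i k) s * moebius_transform (matrix_coeff \<rho> k j) t) =
    moebius_transform (\<lambda>v. \<Sum>k<rep_dim \<rho>. matrix_coeff \<rho> i k v * moebius_transform (matrix_coeff \<rho> k j) t) s"
    by (subst mult.commute, subst moebius_transform_sum[symmetric]) (simp add: mult.commute)
  also have "\<dots> = moebius_transform (\<lambda>v. moebius_transform (\<lambda>w. matrix_coeff \<rho> i j (v * w)) t) s"
    by (simp add: eq)
  finally show "(\<Sum>k<rep_dim \<rho>. moebius_transform (matrix_coeff \<rho> i k) s * moebius_transform (matrix_coeff \<rho> k j) t) =
      (if sdom s = sran t then moebius_transform (matrix_coeff \<rho> i j) (s * t) else 0)"
    by (simp add: moebius_transform_product)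
qed

text \<open>The entry \<open>(i, l)\<close> of the average \<open>(\<Sum>t. \<rho>\<lfloor>t\<rfloor> M \<sigma>\<lfloor>t\<^sup>-\<^sup>1\<rfloor> / n(t))\<close>, where \<open>M\<close> is the elementary matrix
  with entry \<open>1\<close> at \<open>(j, k)\<close>.\<close>

definition averaged_coeff :: "'a::{finite,inverse_semigroup} mat_rep \<Rightarrow> nat \<Rightarrow> nat \<Rightarrow>
    'a mat_rep \<Rightarrow> nat \<Rightarrow> nat \<Rightarrow> complex" where
  "averaged_coeff \<rho> i j \<sigma> k l = (\<Sum>t\<in>UNIV. moebius_transform (matrix_coeff \<rho> i j) t *
     moebius_transform (matrix_coeff \<sigma> k l) (sinv t) / of_nat (arrows_onto (sran t)))"

text \<open>The weight \<open>n\<close> is unchanged by the partial translations, because \<open>s * sran t\<close> is an arrow from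
  \<open>sran t\<close> to \<open>sran (s * t)\<close>.\<close>

lemma arrows_onto_sran_mult:
  assumes "sdom s * t = t"
  shows "arrows_onto (sran (s * t)) = arrows_onto (sran (t::'a::{finite,inverse_semigroup}))"
proof (rule arrows_onto_eq_if_arrow[symmetric])
  have "sdom (s * sran t) = sran t"
    using iffD1[OF sdom_mult_sran assms] by (simp add: sdom_mult_idempotent)
  moreover have "sran (s * sran t) = sran (s * t)"
    by (simp add: sran_def sinv_mult mult.assoc)
  ultimately show "s * sran t \<in> arrows (sran t) (sran (s * t))"
    by (simp add: arrows_def)
qed

lemma arrows_onto_sdom: "arrows_onto (sdom t) = arrows_onto (sran (t::'a::{finite,inverse_semigroup}))"
  by (rule arrows_onto_eq_if_arrow[of t]) (simp add: arrows_def)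

text \<open>The substitution \<open>u = s * t\<close> turns \<open>\<lfloor>s t\<rfloor> \<otimes> \<lfloor>t\<^sup>-\<^sup>1\<rfloor>\<close> into \<open>\<lfloor>u\<rfloor> \<otimes> \<lfloor>u\<^sup>-\<^sup>1 s\<rfloor>\<close>. It maps the \<open>t\<close> with range below
  \<open>sdom s\<close> bijectively onto the \<open>u\<close> with range below \<open>sran s\<close>, and both products vanish for
  all other indices.\<close>

lemma averaged_coeff_intertwines:
  fixes \<rho> \<sigma> :: "'a::{finite,inverse_semigroup} mat_rep"
  assumes \<rho>: "is_rep \<rho>" and \<sigma>: "is_rep \<sigma>"
    and "i < rep_dim \<rho>" "j < rep_dim \<rho>" "k < rep_dim \<sigma>" "l < rep_dim \<sigma>"
  shows "(\<Sum>m<rep_dim \<rho>. matrix_coeff \<rho> i m s * averaged_coeff \<rho> m j \<sigma> k l)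
       = (\<Sum>m<rep_dim \<sigma>. averaged_coeff \<rho> i j \<sigma> k m * matrix_coeff \<sigma> m l s)"
proof -
  let ?A = "moebius_transform (matrix_coeff \<rho> i j)"
  let ?B = "moebius_transform (matrix_coeff \<sigma> k l)"
  let ?n = "\<lambda>t. complex_of_nat (arrows_onto (sran t))"
  have "(\<Sum>m<rep_dim \<rho>. matrix_coeff \<rho> i m s * averaged_coeff \<rho> m j \<sigma> k l)
    = (\<Sum>t\<in>UNIV. (\<Sum>m<rep_dim \<rho>. matrix_coeff \<rho> i m s * moebius_transform (matrix_coeff \<rho> m j) t)
         * ?B (sinv t) / ?n t)"
    unfolding averaged_coeff_def sum_distrib_left sum_distrib_right sum_divide_distrib
    by (subst sum.swap) (simp add: mult.assoc)
  also have "\<dots> = (\<Sum>t\<in>UNIV. if sdom s * t = t then ?A (s * t) * ?B (sinv t) / ?n t else 0)"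
    by (intro sum.cong refl) (simp add: moebius_transform_rep_product(1)[OF \<rho>] assms)
  also have "\<dots> = (\<Sum>t | sdom s * t = t. ?A (s * t) * ?B (sinv t) / ?n t)"
    by (simp add: sum.If_cases)
  also have "\<dots> = (\<Sum>u | sran s * u = u. ?A u * ?B (sinv u * s) / ?n u)"
  proof (rule sum.reindex_bij_witness[where i = "\<lambda>u. sinv s * u" and j = "\<lambda>t. s * t"])
    fix t assume t: "t \<in> {t. sdom s * t = t}"
    then show "sinv s * (s * t) = t" by (simp add: sdom_def mult.assoc)
    show "s * t \<in> {u. sran s * u = u}" by (simp add: sran_absorbs_left)
    have "sinv (s * t) * s = sinv (sdom s * t)"
      by (simp add: sinv_mult sdom_def mult.assoc)
    then have "sinv (s * t) * s = sinv t" using t by simp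
    then show "?A (s * t) * ?B (sinv (s * t) * s) / ?n (s * t) = ?A (s * t) * ?B (sinv t) / ?n t"
      using t by (simp add: arrows_onto_sran_mult)
  next
    fix u assume u: "u \<in> {u. sran s * u = u}"
    then show "s * (sinv s * u) = u" by (simp add: sran_def mult.assoc)
    show "sinv s * u \<in> {t. sdom s * t = t}" using sran_absorbs_left[of "sinv s" u] by simp
  qed
  also have "\<dots> = (\<Sum>t\<in>UNIV. if sran s * t = t then ?A t * ?B (sinv t * s) / ?n t else 0)"
    by (simp add: sum.If_cases)
  also have "\<dots> = (\<Sum>t\<in>UNIV. ?A t * (\<Sum>m<rep_dim \<sigma>. moebius_transform (matrix_coeff \<sigma> k m) (sinv t)
         * matrix_coeff \<sigma> m l s) / ?n t)"
  proof (intro sum.cong refl)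
    fix t :: 'a
    have "sinv t * sran s = sinv t \<longleftrightarrow> sran s * t = t"
      by (metis sinv_mult sinv_sinv sinv_idempotent is_idempotent_sran)
    then show "(if sran s * t = t then ?A t * ?B (sinv t * s) / ?n t else 0) =
      ?A t * (\<Sum>m<rep_dim \<sigma>. moebius_transform (matrix_coeff \<sigma> k m) (sinv t) * matrix_coeff \<sigma> m l s) / ?n t"
      by (simp add: moebius_transform_rep_product(2)[OF \<sigma>] assms)
  qed
  also have "\<dots> = (\<Sum>m<rep_dim \<sigma>. averaged_coeff \<rho> i j \<sigma> k m * matrix_coeff \<sigma> m l s)"
    unfolding averaged_coeff_def sum_distrib_left sum_distrib_right sum_divide_distrib
    by (subst sum.swap) (simp add: mult.assoc)
  finally show ?thesis .
qed

text \<open>The element \<open>(\<Sum>e. \<lfloor>e\<rfloor>)\<close> is the identity of the algebra: the nonzero products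
  \<open>s \<lfloor>e\<rfloor>\<close> are the basis elements \<open>\<lfloor>w\<rfloor>\<close> with \<open>w \<le> s\<close>, whose sum is \<open>s\<close>. A representation need not preserve the identity, but an
  irreducible one does: the image commutes with everything, so it is a scalar by Schur's lemma, and
  the scalar is \<open>1\<close> since some matrix coefficient is nonzero.\<close>

lemma sum_idempotent_transforms:
  fixes \<rho> :: "'a::{finite,inverse_semigroup} mat_rep"
  assumes \<rho>: "irreducible_rep \<rho>" and ij: "i < rep_dim \<rho>" "j < rep_dim \<rho>"
  shows "(\<Sum>e | is_idempotent e. moebius_transform (matrix_coeff \<rho> i j) e) = (if i = j then 1 else 0)"
proof -
  note i\<rho> = irreducible_is_rep[OF \<rho>]
  let ?U = "\<lambda>i j. \<Sum>e | is_idempotent e. moebius_transform (matrix_coeff \<rho> i j) e"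
  have left: "(\<Sum>k<rep_dim \<rho>. matrix_coeff \<rho> i k s * ?U k j) = matrix_coeff \<rho> i j s"
    if ij: "i < rep_dim \<rho>" "j < rep_dim \<rho>" for i j s
  proof -
    let ?A = "moebius_transform (matrix_coeff \<rho> i j)"
    have "(\<Sum>k<rep_dim \<rho>. matrix_coeff \<rho> i k s * ?U k j)
      = (\<Sum>e | is_idempotent e. \<Sum>k<rep_dim \<rho>. matrix_coeff \<rho> i k s * moebius_transform (matrix_coeff \<rho> k j) e)"
      unfolding sum_distrib_left by (rule sum.swap)
    also have "\<dots> = (\<Sum>e | is_idempotent e. if sdom s * e = e then ?A (s * e) else 0)"
      by (simp add: moebius_transform_rep_product(1)[OF i\<rho> ij])
    also have "\<dots> = (\<Sum>e | is_idempotent e \<and> sdom s * e = e. ?A (s * e))"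
      by (rule sum.mono_neutral_cong_right) auto
    also have "\<dots> = (\<Sum>w | natural_le w s. ?A w)"
    proof (rule sum.reindex_bij_witness[where i = sdom and j = "\<lambda>e. s * e"])
      fix e assume e: "e \<in> {e. is_idempotent e \<and> sdom s * e = e}"
      then show "sdom (s * e) = e" by (simp add: sdom_mult_idempotent)
      show "s * e \<in> {w. natural_le w s}" using e by (simp add: natural_le_mult_idempotent)
    next
      fix w assume w: "w \<in> {w. natural_le w s}"
      then show "s * sdom w = w" by (simp add: natural_le_iff_sdom)
      show "sdom w \<in> {e. is_idempotent e \<and> sdom s * e = e}" using w by (simp add: sdom_mono)
    qed simp
    finally show ?thesis by (simp add: sum_moebius_transform)
  qed
  have right: "(\<Sum>k<rep_dim \<rho>. ?U i k * matrix_coeff \<rho> k j s) = matrix_coeff \<rho> i j s"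
    if ij: "i < rep_dim \<rho>" "j < rep_dim \<rho>" for i j s
  proof -
    let ?A = "moebius_transform (matrix_coeff \<rho> i j)"
    have "(\<Sum>k<rep_dim \<rho>. ?U i k * matrix_coeff \<rho> k j s)
      = (\<Sum>e | is_idempotent e. \<Sum>k<rep_dim \<rho>. moebius_transform (matrix_coeff \<rho> i k) e * matrix_coeff \<rho> k j s)"
      unfolding sum_distrib_right by (rule sum.swap)
    also have "\<dots> = (\<Sum>e | is_idempotent e. if e * sran s = e then ?A (e * s) else 0)"
      by (simp add: moebius_transform_rep_product(2)[OF i\<rho> ij])
    also have "\<dots> = (\<Sum>e | is_idempotent e \<and> e * sran s = e. ?A (e * s))"
      by (rule sum.mono_neutral_cong_right) auto
    also have "\<dots> = (\<Sum>w | natural_le w s. ?A w)"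
    proof (rule sum.reindex_bij_witness[where i = sran and j = "\<lambda>e. e * s"])
      fix e assume e: "e \<in> {e. is_idempotent e \<and> e * sran s = e}"
      have "sran (e * s) = sdom (sinv s * e)"
        using e by (metis (no_types, lifting) mem_Collect_eq sdom_sinv sinv_idempotent sinv_mult)
      also have "\<dots> = sran s * e" using e by (simp add: sdom_mult_idempotent)
      also have "\<dots> = e" using e idempotent_commute[of e "sran s"] by simp
      finally show "sran (e * s) = e" .
      show "e * s \<in> {w. natural_le w s}" using e by (simp add: natural_le_mult_idempotent)
    next
      fix w assume w: "w \<in> {w. natural_le w s}"
      then show "sran w * s = w" by (simp add: natural_le_iff_sran)
      show "sran w \<in> {e. is_idempotent e \<and> e * sran s = e}"
        using w sran_mono[of w s] idempotent_commute[of "sran w" "sran s"] by simp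
    qed simp
    finally show ?thesis by (simp add: sum_moebius_transform)
  qed
  obtain c where c: "\<And>i l. i < rep_dim \<rho> \<Longrightarrow> l < rep_dim \<rho> \<Longrightarrow> ?U i l = (if i = l then c else 0)"
    by (rule schur_scalar_coeffs[OF \<rho>, of ?U]) (simp_all add: left right)
  have "\<exists>a b s. a < rep_dim \<rho> \<and> b < rep_dim \<rho> \<and> matrix_coeff \<rho> a b s \<noteq> 0"
  proof (rule ccontr)
    assume "\<not> ?thesis"
    then have "\<rho> f = 0\<^sub>m (rep_dim \<rho>) (rep_dim \<rho>)" for f
      using rep_carrier[OF i\<rho>, of f] by (intro eq_matI) (auto simp: rep_entry[OF i\<rho>])
    then show False using \<rho> unfolding irreducible_rep_def by blast
  qed
  then obtain a b s where ab: "a < rep_dim \<rho>" "b < rep_dim \<rho>" and nz: "matrix_coeff \<rho> a b s \<noteq> 0" by blast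
  have "matrix_coeff \<rho> a b s = (\<Sum>k<rep_dim \<rho>. matrix_coeff \<rho> a k s * ?U k b)"
    by (rule left[OF ab, symmetric])
  also have "\<dots> = (\<Sum>k<rep_dim \<rho>. if k = b then matrix_coeff \<rho> a k s * c else 0)"
    using ab by (intro sum.cong refl) (simp add: c)
  also have "\<dots> = matrix_coeff \<rho> a b s * c" using ab by simp
  finally have "matrix_coeff \<rho> a b s = matrix_coeff \<rho> a b s * c" .
  then have "c = 1" using ab nz by simp
  then show ?thesis using c[OF ij] by simp
qed

text \<open>Under the trace the two factors can be exchanged, which leaves
  \<open>(\<Sum>t. \<lfloor>t\<^sup>-\<^sup>1\<rfloor> \<lfloor>t\<rfloor> / n(t)) = (\<Sum>t. \<lfloor>dom t\<rfloor> / n(t))\<close>. Each idempotent \<open>e\<close> is the domain of exactly as many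
  arrows as the weight counts, so this is \<open>(\<Sum>e. \<lfloor>e\<rfloor>)\<close>.\<close>

lemma trace_averaged_coeff:
  fixes \<rho> :: "'a::{finite,inverse_semigroup} mat_rep"
  assumes \<rho>: "irreducible_rep \<rho>" and jk: "j < rep_dim \<rho>" "k < rep_dim \<rho>"
  shows "(\<Sum>i<rep_dim \<rho>. averaged_coeff \<rho> i j \<rho> k i) = (if j = k then 1 else 0)"
proof -
  note i\<rho> = irreducible_is_rep[OF \<rho>]
  let ?A = "moebius_transform (matrix_coeff \<rho> k j)"
  let ?n = "\<lambda>e::'a. complex_of_nat (arrows_onto e)"
  have "(\<Sum>i<rep_dim \<rho>. averaged_coeff \<rho> i j \<rho> k i)
    = (\<Sum>t\<in>UNIV. (\<Sum>i<rep_dim \<rho>. moebius_transform (matrix_coeff \<rho> k i) (sinv t) *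
        moebius_transform (matrix_coeff \<rho> i j) t) / ?n (sran t))"
    unfolding averaged_coeff_def sum_divide_distrib
    by (subst sum.swap) (simp add: mult.commute)
  also have "\<dots> = (\<Sum>t\<in>UNIV. ?A (sdom t) / ?n (sdom t))"
    using moebius_transform_rep_product(3)[OF i\<rho> jk(2,1)]
    by (simp add: sdom_def[symmetric] arrows_onto_sdom)
  also have "\<dots> = (\<Sum>e | is_idempotent e. \<Sum>t | sdom t = e. ?A (sdom t) / ?n (sdom t))"
    by (subst sum.group[of UNIV "{e. is_idempotent e}" sdom, simplified, symmetric]) auto
  also have "\<dots> = (\<Sum>e | is_idempotent e. ?A e)"
  proof (intro sum.cong refl)
    fix e :: 'a assume "e \<in> {e. is_idempotent e}"
    then have "?n e \<noteq> 0" using arrows_onto_pos[of e] by simp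
    moreover have "(\<Sum>t | sdom t = e. ?A (sdom t) / ?n (sdom t)) = of_nat (card {t. sdom t = e}) * (?A e / ?n e)"
      by simp
    ultimately show "(\<Sum>t | sdom t = e. ?A (sdom t) / ?n (sdom t)) = ?A e"
      unfolding card_same_sdom by simp
  qed
  finally show ?thesis using sum_idempotent_transforms[OF \<rho> jk(2,1)] by auto
qed

text \<open>The average intertwines, so Schur's lemma makes it zero or scalar, and its trace fixes the
  scalar.\<close>

lemma schur_orthogonality:
  fixes \<rho> \<sigma> :: "'a::{finite,inverse_semigroup} mat_rep"
  assumes \<rho>: "irreducible_rep \<rho>" and \<sigma>: "irreducible_rep \<sigma>"
    and eq: "equivalent_rep \<rho> \<sigma> \<Longrightarrow> \<rho> = \<sigma>"
    and ij: "i < rep_dim \<rho>" "j < rep_dim \<rho>" and kl: "k < rep_dim \<sigma>" "l < rep_dim \<sigma>"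
  shows "averaged_coeff \<rho> i j \<sigma> k l = (if \<rho> = \<sigma> \<and> i = l \<and> j = k then 1 / of_nat (rep_dim \<rho>) else 0)"
proof (cases "\<rho> = \<sigma>")
  case False
  then have ne: "\<not> equivalent_rep \<rho> \<sigma>" using eq by blast
  have "averaged_coeff \<rho> i j \<sigma> k l = 0"
    by (rule schur_zero_coeffs[OF \<rho> \<sigma> ne, of "\<lambda>i l. averaged_coeff \<rho> i j \<sigma> k l",
          OF averaged_coeff_intertwines[OF irreducible_is_rep[OF \<rho>] irreducible_is_rep[OF \<sigma>] _ ij(2) kl(1)]
            ij(1) kl(2)])
  then show ?thesis using False by simp
next
  case True
  note i\<rho> = irreducible_is_rep[OF \<rho>]
  have k: "k < rep_dim \<rho>" "l < rep_dim \<rho>" using kl True by simp_all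
  obtain c where c: "\<And>i l. i < rep_dim \<rho> \<Longrightarrow> l < rep_dim \<rho> \<Longrightarrow>
      averaged_coeff \<rho> i j \<rho> k l = (if i = l then c else 0)"
    by (rule schur_scalar_coeffs[OF \<rho>, of "\<lambda>i l. averaged_coeff \<rho> i j \<rho> k l"])
      (simp_all add: averaged_coeff_intertwines[OF i\<rho> i\<rho> _ ij(2) k(1)])
  have "of_nat (rep_dim \<rho>) * c = (if j = k then 1 else 0)"
    using trace_averaged_coeff[OF \<rho> ij(2) k(1)] by (simp add: c)
  then have "c = (if j = k then 1 / of_nat (rep_dim \<rho>) else 0)"
    using irreducible_dim_pos[OF \<rho>] by (auto simp: field_simps)
  then show ?thesis using c[OF ij(1) k(2)] True by simp
qed

section \<open>There are finitely many irreducible representations\<close>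

text \<open>Biorthogonal families of functions on a finite set are not longer than the set: padding their
  two rectangular matrices with zeros to square ones would otherwise give a right inverse that is
  not a left inverse.\<close>

lemma biorthogonal_card_le:
  fixes a b :: "'b \<Rightarrow> 's::finite \<Rightarrow> complex"
  assumes Y: "finite Y"
    and orth: "\<And>x y. x \<in> Y \<Longrightarrow> y \<in> Y \<Longrightarrow> (\<Sum>t\<in>UNIV. a x t * b y t) = (if x = y then 1 else 0)"
  shows "card Y \<le> card (UNIV :: 's set)"
proof (rule ccontr)
  let ?N = "card (UNIV :: 's set)" and ?m = "card Y"
  assume "\<not> ?m \<le> ?N"
  then have less: "?N < ?m" by simp
  obtain h where h: "bij_betw h {..<?m} Y"
    using ex_bij_betw_nat_finite[OF Y] by (auto simp: atLeast0LessThan)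
  obtain g where g: "bij_betw g {..<?N} (UNIV :: 's set)"
    using ex_bij_betw_nat_finite[OF finite_UNIV] by (auto simp: atLeast0LessThan)
  define A where "A = mat ?m ?m (\<lambda>(i, t). if t < ?N then a (h i) (g t) else 0)"
  define B where "B = mat ?m ?m (\<lambda>(t, j). if t < ?N then b (h j) (g t) else 0)"
  have A: "A \<in> carrier_mat ?m ?m" and B: "B \<in> carrier_mat ?m ?m" by (simp_all add: A_def B_def)
  have "A * B = 1\<^sub>m ?m"
  proof (rule eq_matI)
    fix i j assume "i < dim_row (1\<^sub>m ?m :: complex mat)" "j < dim_col (1\<^sub>m ?m :: complex mat)"
    then have ij: "i < ?m" "j < ?m" by simp_all
    have "(A * B) $$ (i, j) = (\<Sum>t<?m. if t < ?N then a (h i) (g t) * b (h j) (g t) else 0)"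
      unfolding mat_mult_entry[OF A B ij] using ij
      by (intro sum.cong refl) (simp add: A_def B_def)
    also have "\<dots> = (\<Sum>t<?N. a (h i) (g t) * b (h j) (g t))"
      using less by (intro sum.mono_neutral_cong_right) auto
    also have "\<dots> = (\<Sum>t\<in>UNIV. a (h i) t * b (h j) t)"
      by (rule sum.reindex_bij_betw[OF g])
    also have "\<dots> = (if h i = h j then 1 else 0)"
      using h ij by (intro orth) (auto simp: bij_betw_def)
    also have "\<dots> = 1\<^sub>m ?m $$ (i, j)"
      using h ij by (auto simp: bij_betw_def inj_on_def)
    finally show "(A * B) $$ (i, j) = 1\<^sub>m ?m $$ (i, j)" .
  qed (use A B in auto)
  then have "B * A = 1\<^sub>m ?m" by (rule mat_mult_left_right_inverse[OF A B])
  then have "(B * A) $$ (?N, ?N) = 1" using less by simp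
  moreover have "(B * A) $$ (?N, ?N) = 0"
    unfolding mat_mult_entry[OF B A less less] using less
    by (intro sum.neutral) (simp add: B_def)
  ultimately show False by simp
qed

lemma equivalent_rep_refl: "is_rep \<rho> \<Longrightarrow> equivalent_rep \<rho> \<rho>"
  unfolding equivalent_rep_def using similar_mat_wit_refl[OF rep_carrier] by blast

lemma complete_irreducible_repsD:
  assumes X: "complete_irreducible_reps X"
  shows "\<rho> \<in> X \<Longrightarrow> irreducible_rep \<rho>"
    and "\<rho> \<in> X \<Longrightarrow> \<sigma> \<in> X \<Longrightarrow> equivalent_rep \<rho> \<sigma> \<Longrightarrow> \<rho> = \<sigma>"
    and "irreducible_rep \<sigma> \<Longrightarrow> \<exists>\<rho>\<in>X. equivalent_rep \<rho> \<sigma>"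
proof -
  show *: "irreducible_rep \<rho>" if "\<rho> \<in> X" for \<rho>
    using X that unfolding complete_irreducible_reps_def by blast
  show "\<exists>\<rho>\<in>X. equivalent_rep \<rho> \<sigma>" if "irreducible_rep \<sigma>"
    using X that unfolding complete_irreducible_reps_def by blast
  show "\<rho> = \<sigma>" if "\<rho> \<in> X" "\<sigma> \<in> X" "equivalent_rep \<rho> \<sigma>"
  proof -
    have "\<exists>!\<tau>. \<tau> \<in> X \<and> equivalent_rep \<tau> \<sigma>"
      using X *[OF that(2)] unfolding complete_irreducible_reps_def by blast
    moreover have "equivalent_rep \<sigma> \<sigma>"
      by (rule equivalent_rep_refl[OF irreducible_is_rep[OF *[OF that(2)]]])
    ultimately show ?thesis using that by blast
  qed
qed

text \<open>By orthogonality the coefficients at \<open>(0, 0)\<close>, one for each representation, are biorthogonal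
  after rescaling.\<close>

lemma finite_complete_irreducible_reps:
  fixes X :: "'a::{finite,inverse_semigroup} mat_rep set"
  assumes X: "complete_irreducible_reps X"
  shows "finite X"
proof (rule ccontr)
  assume "infinite X"
  then obtain Y where Y: "finite Y" "card Y = Suc (card (UNIV :: 'a set))" "Y \<subseteq> X"
    using infinite_arbitrarily_large by blast
  \<comment> \<open>The factors of \<open>?a\<close> make the sum over \<open>?a \<rho> t * ?b \<sigma> t\<close> equal to \<open>d\<^sub>\<rho>\<close> times the averaged coefficient.\<close>
  let ?a = "\<lambda>\<rho> t. of_nat (rep_dim \<rho>) * moebius_transform (matrix_coeff \<rho> 0 0) t / of_nat (arrows_onto (sran t))"
  let ?b = "\<lambda>\<rho> t. moebius_transform (matrix_coeff \<rho> 0 0) (sinv t)"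
  have "card Y \<le> card (UNIV :: 'a set)"
  proof (rule biorthogonal_card_le[OF Y(1), of ?a ?b])
    fix \<rho> \<sigma> assume "\<rho> \<in> Y" "\<sigma> \<in> Y"
    then have r: "\<rho> \<in> X" "\<sigma> \<in> X" using Y by auto
    note irr = complete_irreducible_repsD(1)[OF X]
    have "(\<Sum>t\<in>UNIV. ?a \<rho> t * ?b \<sigma> t) = of_nat (rep_dim \<rho>) * averaged_coeff \<rho> 0 0 \<sigma> 0 0"
      unfolding averaged_coeff_def sum_distrib_left by (simp add: mult.assoc)
    also have "\<dots> = of_nat (rep_dim \<rho>) * (if \<rho> = \<sigma> then 1 / of_nat (rep_dim \<rho>) else 0)"
      by (simp add: schur_orthogonality[OF irr[OF r(1)] irr[OF r(2)] complete_irreducible_repsD(2)[OF X r]]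
        irreducible_dim_pos irr r)
    also have "\<dots> = (if \<rho> = \<sigma> then 1 else 0)"
      using irreducible_dim_pos[OF irr[OF r(1)]] by auto
    finally show "(\<Sum>t\<in>UNIV. ?a \<rho> t * ?b \<sigma> t) = (if \<rho> = \<sigma> then 1 else 0)" .
  qed
  then show False using Y by simp
qed

section \<open>Semisimplicity\<close>

text \<open>A basis of a proper nonzero subspace \<open>W\<close>, extended to the whole space and written as the columns
  of \<open>P\<close>. The coordinates \<open>Q *\<^sub>v w\<close> of a vector \<open>w\<close> of \<open>W\<close> then vanish from position \<open>k\<close> on.\<close>

lemma (in vec_space) adapted_basis:
  assumes W: "VectorSpace.subspace class_ring W V"
    and nz: "W \<noteq> {0\<^sub>v n}" and proper: "W \<noteq> carrier_vec n"
  obtains k P Q where "0 < k" "k < n" "P \<in> carrier_mat n n" "Q \<in> carrier_mat n n"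
    "P * Q = 1\<^sub>m n" "Q * P = 1\<^sub>m n" "\<And>j. j < k \<Longrightarrow> col P j \<in> W"
    "\<And>w i. w \<in> W \<Longrightarrow> k \<le> i \<Longrightarrow> i < n \<Longrightarrow> (Q *\<^sub>v w) $ i = 0"
proof -
  have sub: "submodule class_ring W V" using W unfolding VectorSpace.subspace_def by blast
  then have Wc: "W \<subseteq> carrier_vec n" using submodule.subset by fastforce
  have bound: "finite S \<and> card S \<le> n" if "S \<subseteq> carrier_vec n" "lin_indpt S" for S
    using li_le_dim[OF fin_dim, of S] that dim_is_n by simp
  have "lin_indpt {}" unfolding lin_dep_def by blast
  then have "\<exists>A. finite A \<and> maximal A (\<lambda>S. S \<subseteq> W \<and> lin_indpt S)"
    by (intro maximal_exists[of _ n "{}"] bound) (use Wc in blast)+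
  then obtain A where fA: "finite A" and mA: "maximal A (\<lambda>S. S \<subseteq> W \<and> lin_indpt S)" by blast
  have AW: "A \<subseteq> W" and lA: "lin_indpt A" using mA unfolding maximal_def by blast+
  have "\<exists>B. finite B \<and> maximal B (\<lambda>S. A \<subseteq> S \<and> S \<subseteq> carrier_vec n \<and> lin_indpt S)"
    using lA AW Wc by (intro maximal_exists[of _ n A] bound) blast+
  then obtain B where fB: "finite B"
    and mB: "maximal B (\<lambda>S. A \<subseteq> S \<and> S \<subseteq> carrier_vec n \<and> lin_indpt S)" by blast
  have AB: "A \<subseteq> B" and Bc: "B \<subseteq> carrier_vec n" and lB: "lin_indpt B"
    using mB unfolding maximal_def by blast+
  have "maximal B (\<lambda>S. S \<subseteq> carrier_vec n \<and> lin_indpt S)"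
    using mB unfolding maximal_def by blast
  then have bB: "basis B" by (rule max_li_is_basis)
  then have cB: "card B = n" using dim_basis[OF fB] dim_is_n by simp
  have Wspan: "w \<in> span A" if w: "w \<in> W" for w
  proof (cases "w \<in> A")
    case True
    then show ?thesis using in_own_span[of A] AW Wc by auto
  next
    case False
    have "lin_dep (A \<union> {w})"
      using mA False w AW unfolding maximal_def by blast
    then show ?thesis using lin_dep_iff_in_span[of A w] lA AW Wc w False by auto
  qed
  have spanW: "span A \<subseteq> W"
    using span_is_subset[OF AW sub] .
  obtain us where us: "set us = A" "distinct us" using finite_distinct_list[OF fA] by blast
  obtain ts where ts: "set ts = B - A" "distinct ts" using finite_distinct_list[of "B - A"] fB by blast
  define k where "k = length us"
  have len: "length (us @ ts) = n"
    using cB us ts AB fB by (metis (no_types, lifting) Diff_disjoint Diff_partition distinct_append distinct_card set_append)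
  define P where "P = mat_of_cols n (us @ ts)"
  have P: "P \<in> carrier_mat n n" unfolding P_def using len by auto
  have colsP: "cols P = us @ ts"
    unfolding P_def by (rule cols_mat_of_cols) (use us ts AB Bc in auto)
  have setP: "set (cols P) = B" unfolding colsP using us ts AB by auto
  have dP: "distinct (cols P)" unfolding colsP using us ts by auto
  have colP: "col P j = (us @ ts) ! j" if "j < n" for j
    using that cols_nth[of j P] P unfolding colsP by simp
  have "rank P = n" by (rule lin_indpt_full_rank[OF P dP]) (use lB setP in simp)
  then have "det P \<noteq> 0" using det_rank_iff[OF P] by simp
  then obtain Q where Q: "Q \<in> carrier_mat n n" "P * Q = 1\<^sub>m n" "Q * P = 1\<^sub>m n"
    using det_non_zero_imp_unit[OF P] by (auto simp: Units_def ring_mat_def)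
  have kn: "k \<le> n" using len by (simp add: k_def)
  have Qw: "(Q *\<^sub>v w) $ i = 0" if w: "w \<in> W" and i: "k \<le> i" "i < n" for w i
  proof -
    obtain a where a: "w = lincomb a A"
      using finite_in_span[OF fA, of w] Wspan[OF w] AW Wc by auto
    let ?a = "\<lambda>v. if v \<in> A then a v else 0"
    have "w = lincomb ?a B"
    proof (rule eq_vecI)
      fix l assume "l < dim_vec (lincomb ?a B)"
      then have l: "l < n" using lincomb_dim[OF fB Bc] by simp
      show "w $ l = lincomb ?a B $ l"
        unfolding a lincomb_index[OF l Bc] lincomb_index[OF l subset_trans[OF AW Wc]]
        using AB fB by (intro sum.mono_neutral_cong_left) auto
    qed (use w Wc lincomb_dim[OF fB Bc] in auto)
    then have "w = P *\<^sub>v vec n (\<lambda>i. ?a (col P i))"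
      using mat_mult_eq_lincomb[OF P dP, of ?a] setP by simp
    then have "Q *\<^sub>v w = (Q * P) *\<^sub>v vec n (\<lambda>i. ?a (col P i))"
      using assoc_mult_mat_vec[OF Q(1) P] by simp
    also have "\<dots> = vec n (\<lambda>i. ?a (col P i))" unfolding Q(3) by simp
    finally have "(Q *\<^sub>v w) $ i = ?a (col P i)" using i by simp
    moreover have "col P i \<in> set ts"
      using i len unfolding colP[OF i(2)] k_def by (auto simp: nth_append)
    ultimately show ?thesis using ts by auto
  qed
  have colW: "col P j \<in> W" if "j < k" for j
    using that kn colP[of j] us AW by (auto simp: nth_append k_def)
  have "k \<noteq> 0"
  proof
    assume "k = 0"
    then have "A = {}" using us by (simp add: k_def)
    then have "W \<subseteq> {0\<^sub>v n}" using Wspan span_empty by auto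
    moreover have "0\<^sub>v n \<in> W" using submodule.zero_closed[OF sub] by simp
    ultimately show False using nz by blast
  qed
  moreover have "k \<noteq> n"
  proof
    assume "k = n"
    then have "card A = n" using us distinct_card[of us] by (simp add: k_def)
    then have "A = B" using card_subset_eq[OF fB AB] cB by simp
    then have "span A = carrier_vec n" using bB unfolding basis_def by simp
    then show False using spanW Wc proper by blast
  qed
  ultimately show thesis
    using that[of k P Q] P Q Qw colW kn by auto
qed

lemma mat_trace_conjugate:
  assumes "M \<in> carrier_mat n n" "P \<in> carrier_mat n n" "Q \<in> carrier_mat n n" and PQ: "P * Q = 1\<^sub>m n"
  shows "mat_trace (Q * M * P) = mat_trace M"
proof -
  have swap: "mat_trace (A * B) = mat_trace (B * A)"
    if A: "A \<in> carrier_mat n n" and B: "B \<in> carrier_mat n n" for A B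
  proof -
    have "mat_trace (A * B) = (\<Sum>i<n. \<Sum>k<n. A $$ (i, k) * B $$ (k, i))"
      unfolding mat_trace_def using A B
      by (intro sum.cong) (auto simp: mat_mult_entry[OF A B] simp del: index_mult_mat(1))
    also have "\<dots> = (\<Sum>k<n. \<Sum>i<n. B $$ (k, i) * A $$ (i, k))"
      by (subst sum.swap) (simp add: mult.commute)
    also have "\<dots> = mat_trace (B * A)"
      unfolding mat_trace_def using A B
      by (intro sum.cong) (auto simp: mat_mult_entry[OF B A] simp del: index_mult_mat(1))
    finally show ?thesis .
  qed
  have "mat_trace (Q * M * P) = mat_trace (Q * (M * P))"
    using assms by (simp add: assoc_mult_mat[of Q n n M n P n])
  also have "\<dots> = mat_trace (M * P * Q)" using assms by (intro swap) auto
  also have "M * P * Q = M" using assms assoc_mult_mat[of M n n P n Q n] by simp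
  finally show ?thesis .
qed

lemma is_rep_conjugate:
  fixes \<rho> :: "'a::{finite,semigroup_mult} mat_rep"
  assumes \<rho>: "is_rep \<rho>" and P: "P \<in> carrier_mat (rep_dim \<rho>) (rep_dim \<rho>)"
    and Q: "Q \<in> carrier_mat (rep_dim \<rho>) (rep_dim \<rho>)" and PQ: "P * Q = 1\<^sub>m (rep_dim \<rho>)"
  shows "is_rep (\<lambda>f. Q * \<rho> f * P)" "rep_dim (\<lambda>f. Q * \<rho> f * P) = rep_dim \<rho>"
proof -
  let ?n = "rep_dim \<rho>"
  note c = rep_carrier[OF \<rho>]
  show d: "rep_dim (\<lambda>f. Q * \<rho> f * P) = rep_dim \<rho>"
    using Q by (simp add: rep_dim_def[of "\<lambda>f. Q * \<rho> f * P"])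
  show "is_rep (\<lambda>f. Q * \<rho> f * P)"
    unfolding is_rep_def d
  proof (intro conjI allI)
    fix f g :: "'a semigroup_algebra" and x :: complex
    show "Q * \<rho> f * P \<in> carrier_mat ?n ?n" using P Q c[of f] by simp
    have Qf: "Q * \<rho> f \<in> carrier_mat ?n ?n" for f using Q c[of f] by simp
    show "Q * \<rho> (\<lambda>s. f s + g s) * P = Q * \<rho> f * P + Q * \<rho> g * P"
      by (simp add: rep_add[OF \<rho>] mult_add_distrib_mat[OF Q c c] add_mult_distrib_mat[OF Qf Qf P])
    show "Q * \<rho> (\<lambda>s. x * f s) * P = x \<cdot>\<^sub>m (Q * \<rho> f * P)"
      by (simp add: rep_smult[OF \<rho>] mult_smult_distrib[OF Q c] mult_smult_assoc_mat[OF Qf P])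
    have "Q * \<rho> f * P * (Q * \<rho> g * P) = Q * \<rho> f * (P * (Q * (\<rho> g * P)))"
      using assoc_mult_mat[OF Q c[of g] P] assoc_mult_mat[OF Qf[of f] P, of "Q * (\<rho> g * P)" ?n] P Q c[of g]
      by simp
    also have "P * (Q * (\<rho> g * P)) = \<rho> g * P"
      using assoc_mult_mat[OF P Q, of "\<rho> g * P" ?n] P c[of g] PQ by simp
    also have "Q * \<rho> f * (\<rho> g * P) = Q * (\<rho> f * \<rho> g) * P"
      using assoc_mult_mat[OF Qf[of f] c[of g] P] assoc_mult_mat[OF Q c[of f] c[of g]] by simp
    finally show "Q * \<rho> (alg_mult f g) * P = Q * \<rho> f * P * (Q * \<rho> g * P)"
      by (simp add: rep_mult[OF \<rho>])
  qed
qed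

lemma sum_split_at:
  fixes F :: "nat \<Rightarrow> complex"
  assumes "k \<le> n"
  shows "(\<Sum>l<n. F l) = (\<Sum>l<k. F l) + (\<Sum>l<n - k. F (l + k))"
proof -
  have "{..<n} = {..<k} \<union> {k..<n}" using assms by auto
  then have "(\<Sum>l<n. F l) = (\<Sum>l<k. F l) + (\<Sum>l\<in>{k..<n}. F l)"
    by (simp add: sum.union_disjoint ivl_disj_int)
  also have "(\<Sum>l\<in>{k..<n}. F l) = (\<Sum>l<n - k. F (l + k))"
    using sum.shift_bounds_nat_ivl[of F 0 k "n - k"] assms by (simp add: atLeast0LessThan)
  finally show ?thesis .
qed

lemma trace_rep_of_coeffs:
  "mat_trace (rep_of_coeffs d m f) = (\<Sum>i<d. \<Sum>s\<in>UNIV. f s * m i i s)"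
  by (simp add: mat_trace_def rep_of_coeffs_def)

text \<open>A representation with a proper nonzero invariant subspace is block triangular in an adapted basis.
  Its trace is the sum of the traces of the two diagonal blocks, which are representations of
  smaller dimension.\<close>

lemma trace_zero_if_irreducibles_vanish:
  fixes \<rho> :: "'a::{finite,semigroup_mult} mat_rep"
  assumes "is_rep \<rho>" and a: "\<And>\<sigma>. irreducible_rep \<sigma> \<Longrightarrow> \<sigma> a = 0\<^sub>m (rep_dim \<sigma>) (rep_dim \<sigma>)"
  shows "mat_trace (\<rho> a) = 0"
  using assms(1)
proof (induction "rep_dim \<rho>" arbitrary: \<rho> rule: less_induct)
  case less
  note \<rho> = less.prems
  let ?n = "rep_dim \<rho>"
  show ?case
  proof (cases "irreducible_rep \<rho> \<or> (\<forall>f. \<rho> f = 0\<^sub>m ?n ?n)")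
    case True
    then have "\<rho> a = 0\<^sub>m ?n ?n" using a by blast
    then show ?thesis by (simp add: mat_trace_def)
  next
    case False
    then obtain W where W: "invariant_subspace \<rho> W" "W \<noteq> {0\<^sub>v ?n}" "W \<noteq> carrier_vec ?n"
      using \<rho> unfolding irreducible_rep_def by blast
    have sub: "VectorSpace.subspace class_ring W (module_vec TYPE(complex) ?n)"
      and inv: "\<And>f w. w \<in> W \<Longrightarrow> \<rho> f *\<^sub>v w \<in> W"
      using W(1) unfolding invariant_subspace_def by auto
    obtain k P Q where k: "0 < k" "k < ?n" and P: "P \<in> carrier_mat ?n ?n" and Q: "Q \<in> carrier_mat ?n ?n"
      and PQ: "P * Q = 1\<^sub>m ?n" "Q * P = 1\<^sub>m ?n" and colW: "\<And>j. j < k \<Longrightarrow> col P j \<in> W"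
      and QW: "\<And>w i. w \<in> W \<Longrightarrow> k \<le> i \<Longrightarrow> i < ?n \<Longrightarrow> (Q *\<^sub>v w) $ i = 0"
      using vec_space.adapted_basis[OF sub W(2,3)] by metis
    define \<tau> where "\<tau> = (\<lambda>f. Q * \<rho> f * P)"
    have \<tau>: "is_rep \<tau>" and d: "rep_dim \<tau> = ?n"
      unfolding \<tau>_def by (rule is_rep_conjugate[OF \<rho> P Q PQ(1)])+
    let ?m = "matrix_coeff \<tau>"
    have block: "?m i j s = 0" if "k \<le> i" "i < ?n" "j < k" for i j s
    proof -
      let ?M = "\<rho> (alg_basis s)"
      have M: "?M \<in> carrier_mat ?n ?n" by (rule rep_carrier[OF \<rho>])
      have j: "j < ?n" using that k by simp
      have "?m i j s = (Q * (?M * P)) $$ (i, j)"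
        unfolding matrix_coeff_def \<tau>_def using assoc_mult_mat[OF Q M P] by simp
      also have "\<dots> = col (Q * (?M * P)) j $ i" using Q P M that j by simp
      also have "col (Q * (?M * P)) j = Q *\<^sub>v (?M *\<^sub>v col P j)"
        using col_mult2[OF Q _ j, of "?M * P"] col_mult2[OF M P j] M P by simp
      also have "\<dots> $ i = 0" using that by (intro QW inv colW) auto
      finally show ?thesis .
    qed
    have mult: "?m i j (s * t) = (\<Sum>l<k. ?m i l s * ?m l j t) + (\<Sum>l<?n - k. ?m i (l + k) s * ?m (l + k) j t)"
      if "i < ?n" "j < ?n" for i j s t
      using matrix_coeff_mult[OF \<tau>, of i j s t] that k unfolding d
      by (simp add: sum_split_at[of k ?n])
    let ?\<rho>1 = "rep_of_coeffs k ?m"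
    let ?\<rho>2 = "rep_of_coeffs (?n - k) (\<lambda>i j. ?m (i + k) (j + k))"
    have "is_rep ?\<rho>1"
      using k by (intro is_rep_rep_of_coeffs) (simp add: mult block)
    moreover have "is_rep ?\<rho>2"
      using k by (intro is_rep_rep_of_coeffs) (simp add: mult block)
    ultimately have "mat_trace (?\<rho>1 a) = 0" "mat_trace (?\<rho>2 a) = 0"
      using k by (auto intro!: less.hyps)
    moreover have "mat_trace (\<rho> a) = mat_trace (\<tau> a)"
      unfolding \<tau>_def by (rule mat_trace_conjugate[OF rep_carrier[OF \<rho>] P Q PQ(1), symmetric])
    moreover have "mat_trace (\<tau> a) = (\<Sum>i<?n. \<Sum>s\<in>UNIV. a s * ?m i i s)"
      unfolding mat_trace_def using rep_carrier[OF \<tau>, of a] d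
      by (auto intro!: sum.cong simp: rep_entry[OF \<tau>])
    moreover have "\<dots> = mat_trace (?\<rho>1 a) + mat_trace (?\<rho>2 a)"
      unfolding trace_rep_of_coeffs using k by (subst sum_split_at[of k ?n]) auto
    ultimately show ?thesis by simp
  qed
qed

lemma sdom_mult_fixes_iff:
  "sdom (s * t) * y = y \<longleftrightarrow> sdom t * y = y \<and> sdom s * (t * y) = t * (y::'a::inverse_semigroup)"
proof
  assume *: "sdom (s * t) * y = y"
  have y: "y = sinv t * (sdom s * (t * y))"
    using * by (simp add: sdom_def sinv_mult mult.assoc)
  have "sdom t * y = y"
    by (subst (1 2) y) (simp add: sdom_def mult.assoc)
  moreover have "t * y = sran t * sdom s * (t * y)"
    by (subst (1) y) (simp add: sran_def mult.assoc)
  then have "t * y = sdom s * sran t * (t * y)"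
    using idempotent_commute[of "sran t" "sdom s"] by simp
  then have "sdom s * (t * y) = t * y" by (simp add: mult.assoc sran_absorbs_left)
  ultimately show "sdom t * y = y \<and> sdom s * (t * y) = t * y" by simp
next
  assume *: "sdom t * y = y \<and> sdom s * (t * y) = t * y"
  have "sdom (s * t) * y = sinv t * (sdom s * (t * y))"
    by (simp add: sdom_def sinv_mult mult.assoc)
  also have "\<dots> = sdom t * y" using * by (simp add: sdom_def mult.assoc)
  finally show "sdom (s * t) * y = y" using * by simp
qed

text \<open>The action by partial bijections \<open>y \<mapsto> s * y\<close> has the 0-1 matrices \<open>?p\<close>; its trace is
  \<open>fixed_arrows\<close>.\<close>

lemma sum_alg_mult_fixed_arrows_eq_0:
  fixes a b :: "'a::{finite,inverse_semigroup} semigroup_algebra"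
  assumes a: "\<And>\<sigma>. irreducible_rep \<sigma> \<Longrightarrow> \<sigma> a = 0\<^sub>m (rep_dim \<sigma>) (rep_dim \<sigma>)"
  shows "(\<Sum>s\<in>UNIV. alg_mult a b s * of_nat (fixed_arrows s)) = 0"
proof -
  let ?N = "card (UNIV :: 'a set)"
  obtain g where g: "bij_betw g {..<?N} (UNIV :: 'a set)"
    using ex_bij_betw_nat_finite[OF finite_UNIV] by (auto simp: atLeast0LessThan)
  let ?p = "\<lambda>x y s. if x = s * y \<and> sdom s * y = y then 1 else (0::complex)"
  let ?m = "\<lambda>i j. ?p (g i) (g j)"
  have "is_rep (rep_of_coeffs ?N ?m)"
  proof (rule is_rep_rep_of_coeffs)
    fix i j s t
    have "(\<Sum>k<?N. ?m i k s * ?m k j t) = (\<Sum>x\<in>UNIV. ?p (g i) x s * ?p x (g j) t)"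
      by (rule sum.reindex_bij_betw[OF g])
    also have "\<dots> = (\<Sum>x\<in>UNIV. if x = t * g j then ?p (g i) x s * (if sdom t * g j = g j then 1 else 0) else 0)"
      by (intro sum.cong refl) auto
    also have "\<dots> = ?m i j (s * t)"
      by (simp add: sdom_mult_fixes_iff mult.assoc)
    finally show "?m i j (s * t) = (\<Sum>k<?N. ?m i k s * ?m k j t)" by simp
  qed
  moreover have "\<sigma> (alg_mult a b) = 0\<^sub>m (rep_dim \<sigma>) (rep_dim \<sigma>)" if "irreducible_rep \<sigma>" for \<sigma>
    using rep_mult[OF irreducible_is_rep[OF that], of a b] rep_carrier[OF irreducible_is_rep[OF that], of b]
    by (simp add: a[OF that])
  ultimately have "mat_trace (rep_of_coeffs ?N ?m (alg_mult a b)) = 0"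
    by (rule trace_zero_if_irreducibles_vanish)
  moreover have "(\<Sum>i<?N. ?m i i s) = of_nat (fixed_arrows s)" for s
  proof -
    have "(\<Sum>i<?N. ?m i i s) = (\<Sum>x\<in>UNIV. ?p x x s)" by (rule sum.reindex_bij_betw[OF g])
    also have "\<dots> = of_nat (card {x. x = s * x \<and> sdom s * x = x})" by (simp add: sum.If_cases)
    also have "{x. x = s * x \<and> sdom s * x = x} = {x. s * x = x}"
    proof -
      have "sdom s * x = x" if "s * x = x" for x
        using sdom_mono[OF iffD1[OF fixes_iff that]]
        by - (rule iffD2[OF sdom_mult_sran], simp only: sdom_idempotent is_idempotent_sran)
      then show ?thesis by auto
    qed
    finally show ?thesis by (simp add: fixed_arrows_def)
  qed
  ultimately show ?thesis
    unfolding trace_rep_of_coeffs by (subst (asm) sum.swap) (simp add: sum_distrib_left[symmetric])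
qed

text \<open>Elements of the algebra killed by every irreducible representation form its radical, so this is
  semisimplicity. In the vanishing trace of \<open>a b\<close> the factor \<open>b\<close> is chosen as
  \<open>\<lfloor>t\<^sup>-\<^sup>1\<rfloor>\<close>, whose coefficients are \<open>?b\<close>.\<close>

lemma irreducibles_separate:
  fixes a :: "'a::{finite,inverse_semigroup} semigroup_algebra"
  assumes a: "\<And>\<sigma>. irreducible_rep \<sigma> \<Longrightarrow> \<sigma> a = 0\<^sub>m (rep_dim \<sigma>) (rep_dim \<sigma>)"
  shows "a s = 0"
proof -
  have "(\<Sum>s | natural_le t s. a s) = 0" for t
  proof -
    let ?b = "\<lambda>v. if natural_le v (sinv t) then of_int (moebius v (sinv t)) else (0::complex)"
    have "(\<Sum>y\<in>UNIV. ?b y * of_nat (fixed_arrows (x * y)))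
      = moebius_transform (\<lambda>v. of_nat (fixed_arrows (x * v))) (sinv t)" for x
      unfolding moebius_transform_def by (rule sum.mono_neutral_cong_right) auto
    then have "(\<Sum>s\<in>UNIV. a s * moebius_transform (\<lambda>v. of_nat (fixed_arrows (s * v))) (sinv t))
      = (\<Sum>s\<in>UNIV. alg_mult a ?b s * of_nat (fixed_arrows s))"
      unfolding sum_alg_mult mult.assoc sum_distrib_left[symmetric] by simp
    also have "\<dots> = 0" by (rule sum_alg_mult_fixed_arrows_eq_0[OF a])
    finally show ?thesis
      unfolding sum_fixed_arrows_transform using arrows_onto_pos[of "sran t"] by simp
  qed
  then show ?thesis using moebius_inversion_upward[of s a] by simp
qed

section \<open>Fourier inversion\<close>

text \<open>The inner sum of the inversion formula is the trace of \<open>\<rho>(f) \<rho>\<lfloor>t\<^sup>-\<^sup>1\<rfloor>\<close>.\<close>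

lemma sum_transformed_trace:
  fixes \<rho> :: "'a::{finite,inverse_semigroup} mat_rep"
  assumes \<rho>: "is_rep \<rho>"
  shows "(\<Sum>v | natural_le (sinv v) (sinv t). of_int (moebius (sinv v) (sinv t)) *
      mat_trace (\<rho> f * \<rho> (alg_basis (sinv v))))
    = (\<Sum>i<rep_dim \<rho>. \<Sum>j<rep_dim \<rho>. \<rho> f $$ (i, j) * moebius_transform (matrix_coeff \<rho> j i) (sinv t))"
proof -
  note c = rep_carrier[OF \<rho>]
  have tr: "mat_trace (\<rho> f * \<rho> (alg_basis u))
    = (\<Sum>i<rep_dim \<rho>. \<Sum>j<rep_dim \<rho>. \<rho> f $$ (i, j) * matrix_coeff \<rho> j i u)" for u
    unfolding mat_trace_def matrix_coeff_def using c[of f]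
    by (intro sum.cong) (auto simp: mat_mult_entry[OF c c] simp del: index_mult_mat(1))
  have "(\<Sum>v | natural_le (sinv v) (sinv t). of_int (moebius (sinv v) (sinv t)) *
      mat_trace (\<rho> f * \<rho> (alg_basis (sinv v))))
    = moebius_transform (\<lambda>u. mat_trace (\<rho> f * \<rho> (alg_basis u))) (sinv t)"
    unfolding moebius_transform_def
    by (rule sum.reindex_bij_witness[where i = sinv and j = sinv])
      (simp_all del: natural_le_sinv_iff)
  also have "\<dots> = (\<Sum>i<rep_dim \<rho>. \<Sum>j<rep_dim \<rho>. \<rho> f $$ (i, j) * moebius_transform (matrix_coeff \<rho> j i) (sinv t))"
    unfolding tr
    using moebius_transform_sum[where c = "\<lambda>_. 1" and K = "{..<rep_dim \<rho>}" and
        F = "\<lambda>i u. \<Sum>j<rep_dim \<rho>. \<rho> f $$ (i, j) * matrix_coeff \<rho> j i u" and t = "sinv t"]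
    by (simp add: moebius_transform_sum)
  finally show ?thesis .
qed

lemma rep_zero_if_equivalent:
  assumes \<rho>: "is_rep \<rho>" and \<sigma>: "is_rep \<sigma>" and eq: "equivalent_rep \<rho> \<sigma>"
    and a: "\<rho> a = 0\<^sub>m (rep_dim \<rho>) (rep_dim \<rho>)"
  shows "\<sigma> a = 0\<^sub>m (rep_dim \<sigma>) (rep_dim \<sigma>)"
proof -
  obtain P Q where "\<forall>f. similar_mat_wit (\<rho> f) (\<sigma> f) P Q"
    using eq unfolding equivalent_rep_def by blast
  then have "similar_mat_wit (\<sigma> a) (\<rho> a) Q P" using similar_mat_wit_sym by blast
  note wit = similar_mat_witD2[OF rep_carrier[OF \<sigma>] this]
  have "rep_dim \<rho> = rep_dim \<sigma>" using carrier_matD(1)[OF wit(5)] unfolding a by simp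
  then show ?thesis unfolding wit(3) a using wit(6,7) by simp
qed

text \<open>The right-hand side is a function \<open>f'\<close> with groupoid coefficients \<open>?F\<close>. By orthogonality every
  irreducible representation in \<open>X\<close> sends \<open>f'\<close> and \<open>f\<close> to the same matrix, so \<open>f' = f\<close>.\<close>

lemma fourier_inversion_matrix_coeffs:
  fixes X :: "'a::{finite,inverse_semigroup} mat_rep set"
  assumes X: "complete_irreducible_reps X"
  shows "f s = (\<Sum>t | natural_le s t. of_int (moebius s t) *
    (\<Sum>\<rho>\<in>X. of_nat (rep_dim \<rho>) *
      (\<Sum>i<rep_dim \<rho>. \<Sum>j<rep_dim \<rho>. \<rho> f $$ (i, j) * moebius_transform (matrix_coeff \<rho> j i) (sinv t))
      / of_nat (arrows_onto (sran t))))"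
    (is "f s = (\<Sum>t | natural_le s t. of_int (moebius s t) * ?F t)")
proof -
  define f' where "f' s = (\<Sum>t | natural_le s t. of_int (moebius s t) * ?F t)" for s
  note irr = complete_irreducible_repsD(1)[OF X]
  note finX = finite_complete_irreducible_reps[OF X]
  have same: "\<sigma> f' $$ (k, l) = \<sigma> f $$ (k, l)"
    if \<sigma>: "\<sigma> \<in> X" and kl: "k < rep_dim \<sigma>" "l < rep_dim \<sigma>" for \<sigma> k l
  proof -
    let ?c = "\<lambda>t. complex_of_nat (arrows_onto (sran t))"
    let ?M = "\<lambda>\<rho> i j. moebius_transform (matrix_coeff \<rho> i j)"
    have "\<sigma> f' $$ (k, l) = (\<Sum>t\<in>UNIV. ?F t * ?M \<sigma> k l t)"
      unfolding rep_entry[OF irreducible_is_rep[OF irr[OF \<sigma>]] kl] f'_def by (rule sum_moebius_swap)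
    also have "\<dots> = (\<Sum>t\<in>UNIV. \<Sum>\<rho>\<in>X. \<Sum>i<rep_dim \<rho>. \<Sum>j<rep_dim \<rho>.
        of_nat (rep_dim \<rho>) * \<rho> f $$ (i, j) * (?M \<sigma> k l t * ?M \<rho> j i (sinv t) / ?c t))"
      by (simp add: sum_distrib_left sum_distrib_right sum_divide_distrib algebra_simps)
    also have "\<dots> = (\<Sum>\<rho>\<in>X. \<Sum>t\<in>UNIV. \<Sum>i<rep_dim \<rho>. \<Sum>j<rep_dim \<rho>.
        of_nat (rep_dim \<rho>) * \<rho> f $$ (i, j) * (?M \<sigma> k l t * ?M \<rho> j i (sinv t) / ?c t))"
      by (rule sum.swap)
    also have "\<dots> = (\<Sum>\<rho>\<in>X. \<Sum>i<rep_dim \<rho>. \<Sum>t\<in>UNIV. \<Sum>j<rep_dim \<rho>.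
        of_nat (rep_dim \<rho>) * \<rho> f $$ (i, j) * (?M \<sigma> k l t * ?M \<rho> j i (sinv t) / ?c t))"
      by (intro sum.cong refl sum.swap)
    also have "\<dots> = (\<Sum>\<rho>\<in>X. \<Sum>i<rep_dim \<rho>. \<Sum>j<rep_dim \<rho>. \<Sum>t\<in>UNIV.
        of_nat (rep_dim \<rho>) * \<rho> f $$ (i, j) * (?M \<sigma> k l t * ?M \<rho> j i (sinv t) / ?c t))"
      by (intro sum.cong refl sum.swap)
    also have "\<dots> = (\<Sum>\<rho>\<in>X. \<Sum>i<rep_dim \<rho>. \<Sum>j<rep_dim \<rho>.
        of_nat (rep_dim \<rho>) * \<rho> f $$ (i, j) * averaged_coeff \<sigma> k l \<rho> j i)"
      unfolding averaged_coeff_def sum_distrib_left ..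
    also have "\<dots> = (\<Sum>\<rho>\<in>X. \<Sum>i<rep_dim \<rho>. \<Sum>j<rep_dim \<rho>.
        if \<rho> = \<sigma> then if i = k then if j = l then \<sigma> f $$ (k, l) else 0 else 0 else 0)"
    proof (intro sum.cong refl)
      fix \<rho> i j assume \<rho>: "\<rho> \<in> X" and "i \<in> {..<rep_dim \<rho>}" "j \<in> {..<rep_dim \<rho>}"
      then have ij: "j < rep_dim \<rho>" "i < rep_dim \<rho>" by simp_all
      show "of_nat (rep_dim \<rho>) * \<rho> f $$ (i, j) * averaged_coeff \<sigma> k l \<rho> j i
        = (if \<rho> = \<sigma> then if i = k then if j = l then \<sigma> f $$ (k, l) else 0 else 0 else 0)"
        using irreducible_dim_pos[OF irr[OF \<sigma>]]
        by (auto simp: schur_orthogonality[OF irr[OF \<sigma>] irr[OF \<rho>] complete_irreducible_repsD(2)[OF X \<sigma> \<rho>] kl ij])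
    qed
    also have "\<dots> = (\<Sum>\<rho>\<in>X. if \<rho> = \<sigma> then \<sigma> f $$ (k, l) else 0)"
    proof -
      have inner: "(\<Sum>j<d. if i = k then if j = l then c else 0 else 0) = (if i = k then c else 0)"
        if "l < d" for i d and c :: complex
        using that by (cases "i = k") simp_all
      show ?thesis using kl by (intro sum.cong refl) (simp add: inner)
    qed
    also have "\<dots> = \<sigma> f $$ (k, l)" using finX \<sigma> by simp
    finally show ?thesis .
  qed
  have "(\<lambda>s. f s + (- 1) * f' s) s = 0"
  proof (rule irreducibles_separate)
    fix \<sigma> :: "'a mat_rep" assume \<sigma>: "irreducible_rep \<sigma>"
    then obtain \<rho> where \<rho>: "\<rho> \<in> X" "equivalent_rep \<rho> \<sigma>"
      using complete_irreducible_repsD(3)[OF X] by blast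
    note r = irreducible_is_rep[OF irr[OF \<rho>(1)]]
    have "\<rho> (\<lambda>s. f s + (- 1) * f' s) = \<rho> f + (- 1) \<cdot>\<^sub>m \<rho> f'"
      by (simp only: rep_add[OF r] rep_smult[OF r])
    also have "\<dots> = 0\<^sub>m (rep_dim \<rho>) (rep_dim \<rho>)"
      using rep_carrier[OF r, of f] rep_carrier[OF r, of f'] same[OF \<rho>(1)]
      by (intro eq_matI) auto
    finally show "\<sigma> (\<lambda>s. f s + (- 1) * f' s) = 0\<^sub>m (rep_dim \<sigma>) (rep_dim \<sigma>)"
      by (rule rep_zero_if_equivalent[OF r irreducible_is_rep[OF \<sigma>] \<rho>(2)])
  qed
  then show ?thesis by (simp add: f'_def)
qed

theorem theorem3p5:
  fixes f :: "'a::{finite,inverse_semigroup} semigroup_algebra"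
    and X :: "'a mat_rep set"
    and \<epsilon> :: "'a \<Rightarrow> 'a"
    and s :: 'a
  assumes "complete_irreducible_reps X"
    and "\<And>t. is_idempotent (\<epsilon> t) \<and> \<epsilon> t \<in> D_class t"
  shows "f s =
    (\<Sum>\<rho>\<in>X. of_nat (rep_dim \<rho>) *
      (\<Sum>t | natural_le s t.
        of_int (moebius s t) /
          (of_nat (num_idempotents t) * of_nat (card (maximal_subgroup (\<epsilon> t)))) *
        (\<Sum>v | natural_le (sinv v) (sinv t).
          of_int (moebius (sinv v) (sinv t)) *
          mat_trace (fourier_transform f \<rho> * \<rho> (alg_basis (sinv v))))))"
proof -
  let ?T = "\<lambda>\<rho> t. \<Sum>i<rep_dim \<rho>. \<Sum>j<rep_dim \<rho>. \<rho> f $$ (i, j) * moebius_transform (matrix_coeff \<rho> j i) (sinv t)"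
  note reps = irreducible_is_rep[OF complete_irreducible_repsD(1)[OF assms(1)]]
  have weight: "of_nat (num_idempotents t) * of_nat (card (maximal_subgroup (\<epsilon> t)))
    = complex_of_nat (arrows_onto (sran t))" for t
    using arrows_onto_sran[of "\<epsilon> t" t] assms(2) by simp
  have "f s = (\<Sum>t | natural_le s t. \<Sum>\<rho>\<in>X. of_int (moebius s t) *
      (of_nat (rep_dim \<rho>) * ?T \<rho> t / of_nat (arrows_onto (sran t))))"
    using fourier_inversion_matrix_coeffs[OF assms(1), of f s] by (simp only: sum_distrib_left)
  also have "\<dots> = (\<Sum>\<rho>\<in>X. \<Sum>t | natural_le s t. of_int (moebius s t) *
      (of_nat (rep_dim \<rho>) * ?T \<rho> t / of_nat (arrows_onto (sran t))))"
    by (rule sum.swap)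
  also have "\<dots> = (\<Sum>\<rho>\<in>X. of_nat (rep_dim \<rho>) * (\<Sum>t | natural_le s t.
      of_int (moebius s t) / of_nat (arrows_onto (sran t)) * ?T \<rho> t))"
  proof -
    have "a * (d * T / c) = d * (a / c * T)" for a c d T :: complex by simp
    then show ?thesis by (simp only: sum_distrib_left[symmetric])
  qed
  finally show ?thesis
    unfolding weight fourier_transform_def using reps
    by (simp add: sum_transformed_trace del: natural_le_sinv_iff cong: sum.cong)
qed

end
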